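(* Let $A(x,y,c)$ and $B(z,u,c)$ be quantifier-free formulas and $c$ a free variable. The following are equivalent. (1) $\mathsf{EA}\vdash \forall x\exists y\, A(x,y,c)\leftrightarrow\exists z\forall u\, B(z,u,c)$. (2) There exist a binary elementary recursive $\{0,1\}$-valued predicate $f(c,w)$, a natural number $K$ and an elementary recursive function $h:\omega\times\omega\to K=\{0,\dots,K-1\}$ such that, with the usual ordering $<$ on $\omega$, (a) (weakly descending) $\mathsf{EA}\vdash K>h(c,w)\geq h(c,w+1)$; (b) (lowering) $\mathsf{EA}\vdash f(c,w)\neq f(c,w+1)\to h(c,w)>h(c,w+1)$; (c) (reduction) $\mathsf{EA}\vdash\lim_{w\to\infty}f(c,w)=0\to\exists z\forall u\, B(z,u,c)$, $\mathsf{EA}\vdash\lim_{w\to\infty}f(c,w)=1\to\exists x\forall y\,\lnot A(x,y,c)$, and $\mathsf{EA}\vdash\exists z\forall u\, B(z,u,c)\to\forall x\exists y\, A(x,y,c)$.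
   Context: $\mathsf{EA}$ (elementary recursive arithmetic) is the first-order theory whose language has a function symbol for each code of an elementary recursive function, with purely universal defining axioms and induction restricted to quantifier-free formulas. The formula $\lim_{w\to\infty}f(c,w)=\ell$ abbreviates $\exists m\forall w\geq m\, f(c,w)=\ell$. Provability of a formula with free variable $c$ means provability with $c$ free.
   Formalization: In (2), f is required to be {0,1}-valued provably in EA (EA proves f(c,w)=0 or f(c,w)=1), not only in fact; with truth alone, (2) would not imply (1), e.g. when f takes the value 2 after a proof of a contradiction in EA. *)

theory Defs
  imports Main
begin

section \<open>Codes of elementary recursive functions\<close>

text \<open>
  The elementary recursive functions are the closure of the initial functions below under
  composition, bounded summation and bounded multiplication.  \<open>Proj n i\<close> is the \<open>n\<close>-ary projection
  to argument \<open>i\<close>, counted from 0.  \<open>Comp n f gs\<close> is the \<open>n\<close>-ary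
  function \<open>xs \<mapsto> f (g\<^sub>1 xs, \<dots>, g\<^sub>k xs)\<close>; the explicit \<open>n\<close> is needed when \<open>gs\<close> is empty.
  \<open>BSum f\<close> is \<open>(y, xs) \<mapsto> \<Sum>i<y. f (i, xs)\<close>, and \<open>BProd f\<close> the analogous product.
\<close>

datatype code =
    Zero
  | Succ
  | Pred
  | Plus
  | Monus
  | Times
  | Proj nat nat
  | Comp nat code "code list"
  | BSum code
  | BProd code

text \<open>Raw codes can be ill-formed; only those with an arity are function symbols.\<close>

fun has_arity :: "nat \<Rightarrow> code \<Rightarrow> bool" where
  "has_arity n Zero \<longleftrightarrow> n = 0"
| "has_arity n Succ \<longleftrightarrow> n = 1"
| "has_arity n Pred \<longleftrightarrow> n = 1"
| "has_arity n Plus \<longleftrightarrow> n = 2"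
| "has_arity n Monus \<longleftrightarrow> n = 2"
| "has_arity n Times \<longleftrightarrow> n = 2"
| "has_arity n (Proj m i) \<longleftrightarrow> n = m \<and> i < m"
| "has_arity n (Comp m f gs) \<longleftrightarrow>
     n = m \<and> has_arity (length gs) f \<and> (\<forall>g\<in>set gs. has_arity m g)"
| "has_arity n (BSum f) \<longleftrightarrow> 0 < n \<and> has_arity n f"
| "has_arity n (BProd f) \<longleftrightarrow> 0 < n \<and> has_arity n f"

text \<open>The function on \<open>\<omega>\<close> denoted by a code; only meaningful on lists of the right length.\<close>

fun denote :: "code \<Rightarrow> nat list \<Rightarrow> nat" where
  "denote Zero xs = 0"
| "denote Succ xs = Suc (xs ! 0)"
| "denote Pred xs = xs ! 0 - 1"
| "denote Plus xs = xs ! 0 + xs ! 1"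
| "denote Monus xs = xs ! 0 - xs ! 1"
| "denote Times xs = xs ! 0 * xs ! 1"
| "denote (Proj m i) xs = xs ! i"
| "denote (Comp m f gs) xs = denote f (map (\<lambda>g. denote g xs) gs)"
| "denote (BSum f) xs = (\<Sum>i<hd xs. denote f (i # tl xs))"
| "denote (BProd f) xs = (\<Prod>i<hd xs. denote f (i # tl xs))"


section \<open>Terms and formulas\<close>

text \<open>
  Variables are de Bruijn indices.  The only relation symbol is equality; the other connectives
  and the existential quantifier are the usual classical abbreviations.
\<close>

datatype tm = Var nat | App code "tm list"

datatype fm =
    Eq tm tm
  | Fls
  | Imp fm fm
  | Forall fm

definition Neg :: "fm \<Rightarrow> fm" where "Neg p = Imp p Fls"
definition Or :: "fm \<Rightarrow> fm \<Rightarrow> fm" where "Or p q = Imp (Neg p) q"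
definition And :: "fm \<Rightarrow> fm \<Rightarrow> fm" where "And p q = Neg (Imp p (Neg q))"
definition Iff :: "fm \<Rightarrow> fm \<Rightarrow> fm" where "Iff p q = And (Imp p q) (Imp q p)"
definition Exists :: "fm \<Rightarrow> fm" where "Exists p = Neg (Forall (Neg p))"

fun wf_tm :: "tm \<Rightarrow> bool" where
  "wf_tm (Var i) \<longleftrightarrow> True"
| "wf_tm (App f ts) \<longleftrightarrow> has_arity (length ts) f \<and> (\<forall>t\<in>set ts. wf_tm t)"

primrec wf_fm :: "fm \<Rightarrow> bool" where
  "wf_fm (Eq s t) \<longleftrightarrow> wf_tm s \<and> wf_tm t"
| "wf_fm Fls \<longleftrightarrow> True"
| "wf_fm (Imp p q) \<longleftrightarrow> wf_fm p \<and> wf_fm q"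
| "wf_fm (Forall p) \<longleftrightarrow> wf_fm p"

primrec qfree :: "fm \<Rightarrow> bool" where
  "qfree (Eq s t) \<longleftrightarrow> True"
| "qfree Fls \<longleftrightarrow> True"
| "qfree (Imp p q) \<longleftrightarrow> qfree p \<and> qfree q"
| "qfree (Forall p) \<longleftrightarrow> False"

fun fv_tm :: "tm \<Rightarrow> nat set" where
  "fv_tm (Var i) = {i}"
| "fv_tm (App f ts) = (\<Union>t\<in>set ts. fv_tm t)"

primrec fv :: "fm \<Rightarrow> nat set" where
  "fv (Eq s t) = fv_tm s \<union> fv_tm t"
| "fv Fls = {}"
| "fv (Imp p q) = fv p \<union> fv q"
| "fv (Forall p) = {i. Suc i \<in> fv p}"

fun subst_tm :: "(nat \<Rightarrow> tm) \<Rightarrow> tm \<Rightarrow> tm" where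
  "subst_tm \<sigma> (Var i) = \<sigma> i"
| "subst_tm \<sigma> (App f ts) = App f (map (subst_tm \<sigma>) ts)"

definition shift_tm :: "tm \<Rightarrow> tm" where
  "shift_tm = subst_tm (\<lambda>i. Var (Suc i))"

definition under_binder :: "(nat \<Rightarrow> tm) \<Rightarrow> nat \<Rightarrow> tm" where
  "under_binder \<sigma> = case_nat (Var 0) (\<lambda>i. shift_tm (\<sigma> i))"

primrec subst_fm :: "(nat \<Rightarrow> tm) \<Rightarrow> fm \<Rightarrow> fm" where
  "subst_fm \<sigma> (Eq s t) = Eq (subst_tm \<sigma> s) (subst_tm \<sigma> t)"
| "subst_fm \<sigma> Fls = Fls"
| "subst_fm \<sigma> (Imp p q) = Imp (subst_fm \<sigma> p) (subst_fm \<sigma> q)"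
| "subst_fm \<sigma> (Forall p) = Forall (subst_fm (under_binder \<sigma>) p)"

definition shift_fm :: "fm \<Rightarrow> fm" where
  "shift_fm = subst_fm (\<lambda>i. Var (Suc i))"

text \<open>Replace variable 0 by \<open>t\<close> and lower all other indices by one.\<close>

definition inst :: "fm \<Rightarrow> tm \<Rightarrow> fm" where
  "inst p t = subst_fm (case_nat t Var) p"


section \<open>Provability\<close>

text \<open>
  Classical natural deduction with equality.  Free variables of the axioms in \<open>T\<close> are read
  universally: rule \<open>AllI\<close> shifts the assumptions \<open>\<Gamma>\<close> but not \<open>T\<close>.
\<close>

inductive derives :: "fm set \<Rightarrow> fm list \<Rightarrow> fm \<Rightarrow> bool" for T :: "fm set" where
  Ax: "p \<in> T \<Longrightarrow> wf_fm p \<Longrightarrow> derives T \<Gamma> p"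
| Assm: "p \<in> set \<Gamma> \<Longrightarrow> wf_fm p \<Longrightarrow> derives T \<Gamma> p"
| ImpI: "wf_fm p \<Longrightarrow> derives T (p # \<Gamma>) q \<Longrightarrow> derives T \<Gamma> (Imp p q)"
| ImpE: "derives T \<Gamma> (Imp p q) \<Longrightarrow> derives T \<Gamma> p \<Longrightarrow> derives T \<Gamma> q"
| Raa: "wf_fm p \<Longrightarrow> derives T (Neg p # \<Gamma>) Fls \<Longrightarrow> derives T \<Gamma> p"
| AllI: "derives T (map shift_fm \<Gamma>) p \<Longrightarrow> derives T \<Gamma> (Forall p)"
| AllE: "derives T \<Gamma> (Forall p) \<Longrightarrow> wf_tm t \<Longrightarrow> derives T \<Gamma> (inst p t)"
| EqI: "wf_tm t \<Longrightarrow> derives T \<Gamma> (Eq t t)"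
| EqE: "derives T \<Gamma> (Eq s t) \<Longrightarrow> derives T \<Gamma> (inst p s) \<Longrightarrow> derives T \<Gamma> (inst p t)"

definition proves :: "fm set \<Rightarrow> fm \<Rightarrow> bool" (infix "\<turnstile>" 50) where
  "T \<turnstile> p \<longleftrightarrow> derives T [] p"


section \<open>Elementary recursive arithmetic\<close>

abbreviation zero_tm :: tm where "zero_tm \<equiv> App Zero []"
abbreviation succ_tm :: "tm \<Rightarrow> tm" where "succ_tm t \<equiv> App Succ [t]"

primrec numeral_tm :: "nat \<Rightarrow> tm" where
  "numeral_tm 0 = zero_tm"
| "numeral_tm (Suc n) = succ_tm (numeral_tm n)"

text \<open>The ordering is expressed by the atomic formulas \<open>s \<midarrow> t = 0\<close>, resp. \<open>S s \<midarrow> t = 0\<close>,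
  with \<open>\<midarrow>\<close> truncated subtraction.\<close>

abbreviation Le :: "tm \<Rightarrow> tm \<Rightarrow> fm" where "Le s t \<equiv> Eq (App Monus [s, t]) zero_tm"
abbreviation Lt :: "tm \<Rightarrow> tm \<Rightarrow> fm" where "Lt s t \<equiv> Le (succ_tm s) t"

inductive_set EA :: "fm set" where
  succ_nonzero: "Neg (Eq (succ_tm (Var 0)) zero_tm) \<in> EA"
| succ_inj: "Imp (Eq (succ_tm (Var 0)) (succ_tm (Var 1))) (Eq (Var 0) (Var 1)) \<in> EA"
| pred_zero: "Eq (App Pred [zero_tm]) zero_tm \<in> EA"
| pred_succ: "Eq (App Pred [succ_tm (Var 0)]) (Var 0) \<in> EA"
| plus_zero: "Eq (App Plus [Var 0, zero_tm]) (Var 0) \<in> EA"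
| plus_succ: "Eq (App Plus [Var 0, succ_tm (Var 1)]) (succ_tm (App Plus [Var 0, Var 1])) \<in> EA"
| monus_zero: "Eq (App Monus [Var 0, zero_tm]) (Var 0) \<in> EA"
| monus_succ: "Eq (App Monus [Var 0, succ_tm (Var 1)]) (App Pred [App Monus [Var 0, Var 1]]) \<in> EA"
| times_zero: "Eq (App Times [Var 0, zero_tm]) zero_tm \<in> EA"
| times_succ: "Eq (App Times [Var 0, succ_tm (Var 1)])
                  (App Plus [App Times [Var 0, Var 1], Var 0]) \<in> EA"
| proj: "i < n \<Longrightarrow> Eq (App (Proj n i) (map Var [0..<n])) (Var i) \<in> EA"
| comp: "has_arity n (Comp n f gs) \<Longrightarrow>
    Eq (App (Comp n f gs) (map Var [0..<n]))
       (App f (map (\<lambda>g. App g (map Var [0..<n])) gs)) \<in> EA"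
| bsum_zero: "has_arity (Suc n) f \<Longrightarrow>
    Eq (App (BSum f) (zero_tm # map Var [1..<Suc n])) zero_tm \<in> EA"
| bsum_succ: "has_arity (Suc n) f \<Longrightarrow>
    Eq (App (BSum f) (succ_tm (Var 0) # map Var [1..<Suc n]))
       (App Plus [App (BSum f) (Var 0 # map Var [1..<Suc n]),
                  App f (Var 0 # map Var [1..<Suc n])]) \<in> EA"
| bprod_zero: "has_arity (Suc n) f \<Longrightarrow>
    Eq (App (BProd f) (zero_tm # map Var [1..<Suc n])) (succ_tm zero_tm) \<in> EA"
| bprod_succ: "has_arity (Suc n) f \<Longrightarrow>
    Eq (App (BProd f) (succ_tm (Var 0) # map Var [1..<Suc n]))
       (App Times [App (BProd f) (Var 0 # map Var [1..<Suc n]),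
                   App f (Var 0 # map Var [1..<Suc n])]) \<in> EA"
| qf_induct: "wf_fm p \<Longrightarrow> qfree p \<Longrightarrow>
    Imp (inst p zero_tm)
     (Imp (Forall (Imp p (subst_fm (case_nat (succ_tm (Var 0)) (\<lambda>i. Var (Suc i))) p)))
       (Forall p)) \<in> EA"

text \<open>\<open>Lim f c l\<close> is \<open>\<exists>m. \<forall>w\<ge>m. f(c,w) = l\<close>; in the scope of the two quantifiers
  \<open>w\<close> is variable 0 and \<open>m\<close> is variable 1.\<close>

definition Lim :: "code \<Rightarrow> tm \<Rightarrow> tm \<Rightarrow> fm" where
  "Lim f c l =
     Exists (Forall (Imp (Le (Var 1) (Var 0))
                  (Eq (App f [shift_tm (shift_tm c), Var 0]) (shift_tm (shift_tm l)))))"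

text \<open>
  The \<open>\<Pi>\<^sub>2\<close> formula \<open>\<forall>x. \<exists>y. A(x,y,c)\<close> is \<open>Forall (Exists A)\<close> and the \<open>\<Sigma>\<^sub>2\<close> formula
  \<open>\<exists>z. \<forall>u. B(z,u,c)\<close> is \<open>Exists (Forall B)\<close>.  So in \<open>A\<close> the variables \<open>y, x, c\<close> are 0, 1, 2, in \<open>B\<close>
  the variables \<open>u, z, c\<close> are 0, 1, 2, and \<open>c\<close> is variable 0 of the two quantified formulas.
\<close>

definition qf_matrix :: "fm \<Rightarrow> bool" where
  "qf_matrix p \<longleftrightarrow> wf_fm p \<and> qfree p \<and> fv p \<subseteq> {0, 1, 2}"

end

theory Submission
  imports Defs "HOL-Library.Countable_Set"
begin

text \<open>
  By the completeness theorem, EA-provability is truth in all models of EA, and it suffices to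
  consider models whose universe is \<open>nat\<close>.

  Assume (1). Then \<open>\<exists>x. \<forall>y. \<not> A\<close> or \<open>\<exists>z. \<forall>u. B\<close> holds in every model. EA is in effect a
  universal theory: bounded search is a term, so induction passes to substructures. Hence
  Herbrand's theorem for \<open>\<exists>\<forall>\<close> statements gives finitely many candidates, each a term in \<open>c\<close> and
  in counterexamples to the previous candidates, that cannot all be refuted. At stage \<open>w\<close> one
  refutes candidates in turn by the least counterexample below \<open>w\<close>; \<open>h\<close> counts the candidates
  that are left and \<open>f\<close> is the kind of the current one.

  Assume (2). As \<open>h\<close> is bounded by a standard number, an induction on that number outside EA shows
  that \<open>f\<close> has a limit in every model, and the reductions decide the equivalence.
\<close>

section \<open>Substitution\<close>

text \<open>The order of the candidates is essential: refuting one supplies an argument to all later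
  ones. A single finite list must serve all models, standard or not; compactness gives it, and its
  length is what makes the bound \<open>K\<close> standard. Counterexamples are sought below
  \<open>w\<close> because only bounded search is elementary. A search that has succeeded keeps its
  result for larger \<open>w\<close>, so the position in the list only moves forward. What the limit
  of \<open>f\<close> says is then read off by recursion on the list, outside EA, so that no
  induction on formulas with quantifiers is needed inside a model. Models live on \<open>nat\<close>
  because a statement cannot quantify over the types of all universes; term models and substructures
  therefore have to be shown infinite and then renumbered.\<close>

lemma subst_tm_cong: "(\<And>i. i \<in> fv_tm t \<Longrightarrow> \<sigma> i = \<tau> i) \<Longrightarrow> subst_tm \<sigma> t = subst_tm \<tau> t"
  by (induction t) auto

lemma subst_tm_subst_tm: "subst_tm \<tau> (subst_tm \<sigma> t) = subst_tm (\<lambda>i. subst_tm \<tau> (\<sigma> i)) t"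
  by (induction t) auto

lemma subst_tm_Var [simp]: "subst_tm Var t = t"
  by (induction t) (auto intro: map_idI)

lemma wf_subst_tm: "wf_tm t \<Longrightarrow> (\<And>i. wf_tm (\<sigma> i)) \<Longrightarrow> wf_tm (subst_tm \<sigma> t)"
  by (induction t) auto

lemma wf_numeral_tm [simp]: "wf_tm (numeral_tm k)"
  by (induction k) auto

lemma finite_fv_tm [simp]: "finite (fv_tm t)"
  by (induction t) auto

lemma under_binder_simps [simp]:
  "under_binder \<sigma> 0 = Var 0"
  "under_binder \<sigma> (Suc i) = shift_tm (\<sigma> i)"
  by (simp_all add: under_binder_def)

lemma wf_shift_tm [simp]: "wf_tm t \<Longrightarrow> wf_tm (shift_tm t)"
  by (simp add: shift_tm_def wf_subst_tm)

lemma wf_under_binder: "(\<And>i. wf_tm (\<sigma> i)) \<Longrightarrow> wf_tm (under_binder \<sigma> i)"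
  by (cases i) auto

lemma under_binder_Var [simp]: "under_binder Var = Var"
proof
  show "under_binder Var i = Var i" for i by (cases i) (auto simp: shift_tm_def)
qed

lemma subst_under_binder:
  "subst_tm (under_binder \<tau>) (under_binder \<sigma> i) = under_binder (\<lambda>i. subst_tm \<tau> (\<sigma> i)) i"
  by (cases i) (auto simp: shift_tm_def subst_tm_subst_tm)

lemma subst_fm_cong: "(\<And>i. i \<in> fv p \<Longrightarrow> \<sigma> i = \<tau> i) \<Longrightarrow> subst_fm \<sigma> p = subst_fm \<tau> p"
proof (induction p arbitrary: \<sigma> \<tau>)
  case (Eq s t)
  then show ?case by (auto intro: subst_tm_cong)
next
  case (Imp p q)
  then show ?case by fastforce
next
  case (Forall p)
  have "under_binder \<sigma> i = under_binder \<tau> i" if "i \<in> fv p" for i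
    using Forall.prems that by (cases i) auto
  then show ?case using Forall.IH[of "under_binder \<sigma>" "under_binder \<tau>"] by simp
qed auto

lemma subst_fm_subst_fm: "subst_fm \<tau> (subst_fm \<sigma> p) = subst_fm (\<lambda>i. subst_tm \<tau> (\<sigma> i)) p"
  by (induction p arbitrary: \<sigma> \<tau>) (auto simp: subst_tm_subst_tm subst_under_binder)

lemma subst_fm_Var [simp]: "subst_fm Var p = p"
  by (induction p) auto

lemma subst_fm_idI: "(\<And>i. i \<in> fv p \<Longrightarrow> \<sigma> i = Var i) \<Longrightarrow> subst_fm \<sigma> p = p"
  using subst_fm_cong[of p \<sigma> Var] by simp

lemma wf_subst_fm: "wf_fm p \<Longrightarrow> (\<And>i. wf_tm (\<sigma> i)) \<Longrightarrow> wf_fm (subst_fm \<sigma> p)"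
  by (induction p arbitrary: \<sigma>) (auto simp: wf_subst_tm wf_under_binder)

lemma finite_fv [simp]: "finite (fv p)"
proof (induction p)
  case (Forall p)
  have "{i. Suc i \<in> fv p} = Suc -` fv p" by auto
  with Forall show ?case by (simp add: finite_vimageI)
qed auto

lemma fv_subst_tm: "fv_tm (subst_tm \<sigma> t) = (\<Union>i\<in>fv_tm t. fv_tm (\<sigma> i))"
  by (induction t) auto

lemma fv_shift_tm [simp]: "fv_tm (shift_tm t) = Suc ` fv_tm t"
  by (auto simp: shift_tm_def fv_subst_tm)

lemma fv_subst_fm: "fv (subst_fm \<sigma> p) = (\<Union>i\<in>fv p. fv_tm (\<sigma> i))"
proof (induction p arbitrary: \<sigma>)
  case (Forall p)
  have "Suc i \<in> fv_tm (under_binder \<sigma> j) \<longleftrightarrow> (\<exists>k. j = Suc k \<and> i \<in> fv_tm (\<sigma> k))" for i j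
    by (cases j) auto
  then show ?case by (auto simp: Forall.IH)
qed (auto simp: fv_subst_tm)

lemma wf_inst: "wf_fm p \<Longrightarrow> wf_tm t \<Longrightarrow> wf_fm (inst p t)"
  unfolding inst_def by (rule wf_subst_fm) (auto split: nat.split)

lemma inst_under_binder: "inst (subst_fm (under_binder \<sigma>) p) t = subst_fm (case_nat t \<sigma>) p"
  unfolding inst_def subst_fm_subst_fm
  by (rule subst_fm_cong) (auto simp: shift_tm_def subst_tm_subst_tm split: nat.split)

lemma subst_inst: "subst_fm \<sigma> (inst p t) = inst (subst_fm (under_binder \<sigma>) p) (subst_tm \<sigma> t)"
  unfolding inst_under_binder
  unfolding inst_def subst_fm_subst_fm by (rule subst_fm_cong) (auto split: nat.split)

lemma subst_shift: "subst_fm (under_binder \<sigma>) (shift_fm p) = shift_fm (subst_fm \<sigma> p)"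
  unfolding shift_fm_def subst_fm_subst_fm by (simp add: shift_tm_def)

lemma wf_connectives [simp]:
  "wf_fm (Neg p) \<longleftrightarrow> wf_fm p"
  "wf_fm (Or p q) \<longleftrightarrow> wf_fm p \<and> wf_fm q"
  "wf_fm (And p q) \<longleftrightarrow> wf_fm p \<and> wf_fm q"
  "wf_fm (Iff p q) \<longleftrightarrow> wf_fm p \<and> wf_fm q"
  "wf_fm (Exists p) \<longleftrightarrow> wf_fm p"
  by (auto simp: Neg_def Or_def And_def Iff_def Exists_def)

lemma subst_Neg [simp]: "subst_fm \<sigma> (Neg p) = Neg (subst_fm \<sigma> p)"
  by (simp add: Neg_def)

lemma fv_Neg [simp]: "fv (Neg p) = fv p"
  by (simp add: Neg_def)


section \<open>Structural properties of derivability\<close>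

lemma derives_weaken: "derives T \<Gamma> p \<Longrightarrow> set \<Gamma> \<subseteq> set \<Delta> \<Longrightarrow> derives T \<Delta> p"
proof (induction arbitrary: \<Delta> rule: derives.induct)
  case (AllI \<Gamma> p)
  then show ?case by (metis derives.AllI image_mono set_map)
next
  case (ImpI p \<Gamma> q)
  have "set (p # \<Gamma>) \<subseteq> set (p # \<Delta>)" using ImpI.prems by auto
  with ImpI show ?case by (blast intro: derives.ImpI)
next
  case (Raa p \<Gamma>)
  have "set (Neg p # \<Gamma>) \<subseteq> set (Neg p # \<Delta>)" using Raa.prems by auto
  with Raa show ?case by (blast intro: derives.Raa)
next
  case (EqE \<Gamma> s t p)
  then show ?case by (metis derives.EqE)
qed (auto intro: derives.Ax derives.Assm derives.ImpE derives.AllE derives.EqI)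

lemma derives_wf_Fls: "derives T \<Gamma> Fls \<Longrightarrow> wf_fm p \<Longrightarrow> derives T \<Gamma> p"
  by (rule Raa) (auto intro: derives_weaken)

text \<open>\<open>AllE\<close> instantiates one variable and lowers the others, so a simultaneous
  substitution has to go through a block of quantifiers. Index \<open>n\<close> belongs to the
  outermost one and is instantiated first; the shift by \<open>n\<close> that
  \<open>\<sigma> n\<close> undergoes below the other quantifiers is undone by the remaining
  instantiations.\<close>

lemma derives_Forall_pow:
  assumes "derives T \<Gamma> ((Forall ^^ n) p)" "\<And>i. wf_tm (\<sigma> i)"
  shows "derives T \<Gamma> (subst_fm (\<lambda>i. if i < n then \<sigma> i else Var (i - n)) p)"
  using assms(1)
proof (induction n arbitrary: p)
  case 0
  then show ?case by simp
next
  case (Suc n)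
  define \<tau> where "\<tau> = (under_binder ^^ n) (case_nat (\<sigma> n) Var)"
  have subst_pow: "subst_fm \<rho> ((Forall ^^ k) q) = (Forall ^^ k) (subst_fm ((under_binder ^^ k) \<rho>) q)"
    for \<rho> q k
    by (induction k arbitrary: \<rho>) (simp_all add: funpow_swap1[of under_binder])
  have under_pow: "(under_binder ^^ k) \<rho> i =
      (if i < k then Var i else subst_tm (\<lambda>j. Var (j + k)) (\<rho> (i - k)))" for \<rho> k i
  proof (induction k arbitrary: i)
    case (Suc k)
    then show ?case by (cases i) (auto simp: shift_tm_def subst_tm_subst_tm)
  qed simp
  have "derives T \<Gamma> (Forall ((Forall ^^ n) p))" using Suc.prems by simp
  then have "derives T \<Gamma> (inst ((Forall ^^ n) p) (\<sigma> n))" using assms(2) by (rule AllE)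
  then have "derives T \<Gamma> ((Forall ^^ n) (subst_fm \<tau> p))"
    by (simp add: inst_def subst_pow \<tau>_def)
  then have "derives T \<Gamma> (subst_fm (\<lambda>i. if i < n then \<sigma> i else Var (i - n)) (subst_fm \<tau> p))"
    by (rule Suc.IH)
  also have "subst_fm (\<lambda>i. if i < n then \<sigma> i else Var (i - n)) (subst_fm \<tau> p) =
      subst_fm (\<lambda>i. if i < Suc n then \<sigma> i else Var (i - Suc n)) p"
    unfolding subst_fm_subst_fm
  proof (rule subst_fm_cong)
    fix i
    consider "i < n" | "i = n" | "i > n" by linarith
    then show "subst_tm (\<lambda>i. if i < n then \<sigma> i else Var (i - n)) (\<tau> i) =
      (if i < Suc n then \<sigma> i else Var (i - Suc n))"
    proof cases
      case 3
      then obtain k where "i - n = Suc k" by (cases "i - n") auto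
      with 3 show ?thesis by (auto simp: \<tau>_def under_pow)
    qed (auto simp: \<tau>_def under_pow subst_tm_subst_tm)
  qed
  finally show ?case .
qed

text \<open>In the empty context \<open>AllI\<close> has nothing to shift, so an axiom can be closed
  under any number of quantifiers and then instantiated. This settles the \<open>Ax\<close> case of
  \<open>derives_subst\<close>, where \<open>T\<close> need not be closed under
  substitution.\<close>

lemma derives_axiom_instance:
  assumes "p \<in> T" "wf_fm p" "\<And>i. wf_tm (\<sigma> i)"
  shows "derives T \<Gamma> (subst_fm \<sigma> p)"
proof -
  have "derives T [] ((Forall ^^ n) p)" for n
    by (induction n) (simp_all add: assms derives.Ax derives.AllI)
  then have *: "derives T [] (subst_fm (\<lambda>i. if i < n then \<sigma> i else Var (i - n)) p)" for n
    using assms(3) by (rule derives_Forall_pow)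
  obtain n where n: "\<And>i. i \<in> fv p \<Longrightarrow> i < n"
    using finite_nat_set_iff_bounded[of "fv p"] by auto
  have "subst_fm (\<lambda>i. if i < n then \<sigma> i else Var (i - n)) p = subst_fm \<sigma> p"
    by (rule subst_fm_cong) (simp add: n)
  with *[of n] show ?thesis by (auto intro: derives_weaken)
qed

lemma derives_subst:
  "derives T \<Gamma> p \<Longrightarrow> (\<And>i. wf_tm (\<sigma> i)) \<Longrightarrow>
    derives T (map (subst_fm \<sigma>) \<Gamma>) (subst_fm \<sigma> p)"
proof (induction arbitrary: \<sigma> rule: derives.induct)
  case (Ax p \<Gamma>)
  then show ?case by (simp add: derives_axiom_instance)
next
  case (Assm p \<Gamma>)
  then show ?case by (simp add: derives.Assm wf_subst_fm)
next
  case (ImpI p \<Gamma> q)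
  then show ?case by (simp add: derives.ImpI wf_subst_fm)
next
  case (ImpE \<Gamma> p q)
  have "derives T (map (subst_fm \<sigma>) \<Gamma>) (Imp (subst_fm \<sigma> p) (subst_fm \<sigma> q))"
    using ImpE.IH(1)[of \<sigma>] ImpE.prems by simp
  moreover have "derives T (map (subst_fm \<sigma>) \<Gamma>) (subst_fm \<sigma> p)"
    using ImpE.IH(2) ImpE.prems .
  ultimately show ?case by (rule derives.ImpE)
next
  case (Raa p \<Gamma>)
  have "derives T (Neg (subst_fm \<sigma> p) # map (subst_fm \<sigma>) \<Gamma>) Fls"
    using Raa.IH[of \<sigma>] Raa.prems by simp
  then show ?case using wf_subst_fm[OF Raa.hyps(1) Raa.prems] by (rule derives.Raa[rotated])
next
  case (AllI \<Gamma> p)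
  have "map (subst_fm (under_binder \<sigma>)) (map shift_fm \<Gamma>) = map shift_fm (map (subst_fm \<sigma>) \<Gamma>)"
    by (simp add: subst_shift)
  then have "derives T (map shift_fm (map (subst_fm \<sigma>) \<Gamma>)) (subst_fm (under_binder \<sigma>) p)"
    using AllI.IH[of "under_binder \<sigma>"] AllI.prems by (metis wf_under_binder)
  then show ?case by (simp only: subst_fm.simps derives.AllI)
next
  case (AllE \<Gamma> p t)
  then show ?case by (simp add: subst_inst derives.AllE wf_subst_tm)
next
  case (EqI t \<Gamma>)
  then show ?case by (simp add: derives.EqI wf_subst_tm)
next
  case (EqE \<Gamma> s t p)
  then show ?case
    using derives.EqE[of T "map (subst_fm \<sigma>) \<Gamma>" "subst_tm \<sigma> s" "subst_tm \<sigma> t"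
        "subst_fm (under_binder \<sigma>) p"]
    by (simp add: subst_inst)
qed

text \<open>The renaming below sends the eigenvariable \<open>k\<close> to the variable bound by the quantifier.\<close>

lemma derives_Forall_fresh:
  assumes "derives T \<Gamma> (inst q (Var k))" "\<And>p. p \<in> set \<Gamma> \<Longrightarrow> k \<notin> fv p" "k \<notin> fv (Forall q)"
  shows "derives T \<Gamma> (Forall q)"
proof -
  define \<sigma> where "\<sigma> i = (if i = k then Var 0 else Var (Suc i))" for i
  have "map (subst_fm \<sigma>) \<Gamma> = map shift_fm \<Gamma>"
    using assms(2) by (auto simp: shift_fm_def \<sigma>_def intro!: subst_fm_cong)
  moreover have "subst_fm \<sigma> (inst q (Var k)) = q"
    unfolding inst_def subst_fm_subst_fm
    using assms(3) by (intro subst_fm_idI) (auto simp: \<sigma>_def split: nat.split)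
  moreover have "derives T (map (subst_fm \<sigma>) \<Gamma>) (subst_fm \<sigma> (inst q (Var k)))"
    using assms(1) by (rule derives_subst) (simp add: \<sigma>_def)
  ultimately show ?thesis by (metis AllI)
qed


section \<open>Semantics\<close>

text \<open>The universe of a structure is the whole type \<open>'a\<close>.\<close>

fun tval :: "(code \<Rightarrow> 'a list \<Rightarrow> 'a) \<Rightarrow> (nat \<Rightarrow> 'a) \<Rightarrow> tm \<Rightarrow> 'a" where
  "tval I e (Var i) = e i"
| "tval I e (App f ts) = I f (map (tval I e) ts)"

primrec sat :: "(code \<Rightarrow> 'a list \<Rightarrow> 'a) \<Rightarrow> (nat \<Rightarrow> 'a) \<Rightarrow> fm \<Rightarrow> bool" where
  "sat I e (Eq s t) \<longleftrightarrow> tval I e s = tval I e t"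
| "sat I e Fls \<longleftrightarrow> False"
| "sat I e (Imp p q) \<longleftrightarrow> (sat I e p \<longrightarrow> sat I e q)"
| "sat I e (Forall p) \<longleftrightarrow> (\<forall>x. sat I (case_nat x e) p)"

definition model :: "fm set \<Rightarrow> (code \<Rightarrow> 'a list \<Rightarrow> 'a) \<Rightarrow> bool" where
  "model T I \<longleftrightarrow> (\<forall>p\<in>T. \<forall>e. sat I e p)"

lemma sat_connectives [simp]:
  "sat I e (Neg p) \<longleftrightarrow> \<not> sat I e p"
  "sat I e (Or p q) \<longleftrightarrow> sat I e p \<or> sat I e q"
  "sat I e (And p q) \<longleftrightarrow> sat I e p \<and> sat I e q"
  "sat I e (Iff p q) \<longleftrightarrow> (sat I e p \<longleftrightarrow> sat I e q)"
  "sat I e (Exists p) \<longleftrightarrow> (\<exists>x. sat I (case_nat x e) p)"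
  by (auto simp: Neg_def Or_def And_def Iff_def Exists_def)

lemma tval_cong: "(\<And>i. i \<in> fv_tm t \<Longrightarrow> d i = e i) \<Longrightarrow> tval I d t = tval I e t"
proof (induction t)
  case (App f ts)
  then have "map (tval I d) ts = map (tval I e) ts" by auto
  then show ?case by (simp del: map_eq_conv)
qed simp

lemma sat_cong: "(\<And>i. i \<in> fv p \<Longrightarrow> d i = e i) \<Longrightarrow> sat I d p \<longleftrightarrow> sat I e p"
proof (induction p arbitrary: d e)
  case (Eq s t)
  then have "tval I d s = tval I e s" "tval I d t = tval I e t" by (auto intro: tval_cong)
  then show ?case by simp
next
  case (Forall p)
  have "sat I (case_nat x d) p \<longleftrightarrow> sat I (case_nat x e) p" for x
    by (rule Forall.IH) (use Forall.prems in \<open>auto split: nat.split\<close>)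
  then show ?case by simp
next
  case (Imp p q)
  have "sat I d p \<longleftrightarrow> sat I e p" "sat I d q \<longleftrightarrow> sat I e q"
    using Imp.prems by (auto intro!: Imp.IH)
  then show ?case by simp
qed simp

lemma tval_subst: "tval I e (subst_tm \<sigma> t) = tval I (\<lambda>i. tval I e (\<sigma> i)) t"
proof (induction t)
  case (App f ts)
  then have "map (tval I e \<circ> subst_tm \<sigma>) ts = map (tval I (\<lambda>i. tval I e (\<sigma> i))) ts" by auto
  then show ?case by (simp del: map_eq_conv)
qed simp

lemma tval_shift [simp]: "tval I (case_nat x e) (shift_tm t) = tval I e t"
  by (simp add: shift_tm_def tval_subst)

lemma tval_under_binder:
  "tval I (case_nat x e) (under_binder \<sigma> i) = case_nat x (\<lambda>i. tval I e (\<sigma> i)) i"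
  by (cases i) auto

lemma sat_subst: "sat I e (subst_fm \<sigma> p) \<longleftrightarrow> sat I (\<lambda>i. tval I e (\<sigma> i)) p"
  by (induction p arbitrary: \<sigma> e) (auto simp: tval_subst tval_under_binder)

lemma sat_shift: "sat I (case_nat x e) (shift_fm p) \<longleftrightarrow> sat I e p"
  by (simp add: shift_fm_def sat_subst)

lemma sat_inst: "sat I e (inst p t) \<longleftrightarrow> sat I (case_nat (tval I e t) e) p"
  unfolding inst_def sat_subst by (rule sat_cong) (auto split: nat.split)

lemma derives_sound:
  "derives T \<Gamma> p \<Longrightarrow> model T I \<Longrightarrow> (\<And>q. q \<in> set \<Gamma> \<Longrightarrow> sat I e q) \<Longrightarrow> sat I e p"
proof (induction arbitrary: e rule: derives.induct)
  case (AllI \<Gamma> p)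
  have "sat I (case_nat x e) p" for x
    by (rule AllI.IH[OF AllI.prems(1)]) (use AllI.prems(2) in \<open>auto simp: sat_shift\<close>)
  then show ?case by simp
next
  case (ImpI p \<Gamma> q)
  then show ?case by auto
next
  case (Raa p \<Gamma>)
  show ?case
  proof (rule ccontr)
    assume "\<not> sat I e p"
    with Raa.prems have "sat I e Fls" by (intro Raa.IH) auto
    then show False by simp
  qed
qed (simp_all add: model_def sat_inst)

lemma proves_sound: "T \<turnstile> p \<Longrightarrow> model T I \<Longrightarrow> sat I e p"
  unfolding proves_def by (rule derives_sound) auto


section \<open>Model existence\<close>

instance code :: countable by countable_datatype
instance tm :: countable by countable_datatype
instance fm :: countable by countable_datatype

text \<open>Free variables of \<open>T\<close> are universal, those of \<open>S\<close> are fixed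
  parameters; hence \<open>S\<close> enters as assumptions, of which a derivation sees a finite
  list.\<close>

definition consistent :: "fm set \<Rightarrow> fm set \<Rightarrow> bool" where
  "consistent T S \<longleftrightarrow> (\<forall>\<Gamma>. set \<Gamma> \<subseteq> S \<longrightarrow> \<not> derives T \<Gamma> Fls)"

lemma inconsistentI: "set \<Gamma> \<subseteq> S \<Longrightarrow> derives T \<Gamma> Fls \<Longrightarrow> \<not> consistent T S"
  by (auto simp: consistent_def)

lemma inconsistent_insertE:
  assumes "\<not> consistent T (insert p S)"
  obtains \<Gamma> where "set \<Gamma> \<subseteq> S" "derives T (p # \<Gamma>) Fls"
proof -
  from assms obtain \<Gamma> where \<Gamma>: "set \<Gamma> \<subseteq> insert p S" "derives T \<Gamma> Fls"
    by (auto simp: consistent_def)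
  then have "derives T (p # filter (\<lambda>q. q \<noteq> p) \<Gamma>) Fls" by (auto elim: derives_weaken)
  with \<Gamma>(1) that[of "filter (\<lambda>q. q \<noteq> p) \<Gamma>"] show ?thesis by auto
qed

text \<open>Henkin's witness step: a refutation of the new formula proves
  \<open>inst q (Var k)\<close> from finitely many members of \<open>S\<close>; as \<open>k\<close>
  is fresh, this generalizes to \<open>Forall q\<close>, against
  \<open>Neg (Forall q)\<close>.\<close>

lemma consistent_insert_counterexample:
  assumes "consistent T S" "Neg (Forall q) \<in> S" "wf_fm q"
    and "k \<notin> (\<Union>p\<in>S. fv p)"
  shows "consistent T (insert (Neg (inst q (Var k))) S)"
proof (rule ccontr)
  assume "\<not> ?thesis"
  then obtain \<Gamma> where \<Gamma>: "set \<Gamma> \<subseteq> S" "derives T (Neg (inst q (Var k)) # \<Gamma>) Fls"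
    by (rule inconsistent_insertE)
  then have "derives T \<Gamma> (inst q (Var k))"
    using assms(3) by (intro Raa[OF wf_inst]) auto
  then have "derives T \<Gamma> (Forall q)"
    by (rule derives_Forall_fresh) (use assms \<Gamma> in auto)
  then have "derives T (Neg (Forall q) # \<Gamma>) (Forall q)" by (auto elim: derives_weaken)
  moreover have "derives T (Neg (Forall q) # \<Gamma>) (Imp (Forall q) Fls)"
    unfolding Neg_def[symmetric] using assms(3) by (auto intro: Assm)
  ultimately have "derives T (Neg (Forall q) # \<Gamma>) Fls" by (blast intro: ImpE)
  moreover have "set (Neg (Forall q) # \<Gamma>) \<subseteq> S" using assms \<Gamma> by auto
  ultimately show False using assms(1) by (auto simp: consistent_def)
qed

section \<open>Henkin sets: maximal consistent sets with witnesses\<close>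

locale saturated =
  fixes T H :: "fm set"
  assumes cons: "consistent T H"
    and maximal: "wf_fm p \<Longrightarrow> consistent T (insert p H) \<Longrightarrow> p \<in> H"
    and witness: "wf_fm q \<Longrightarrow> Neg (Forall q) \<in> H \<Longrightarrow> \<exists>t. wf_tm t \<and> Neg (inst q t) \<in> H"
    and wf: "p \<in> H \<Longrightarrow> wf_fm p"
begin

lemma mem_if_derives:
  assumes "derives T \<Gamma> p" "set \<Gamma> \<subseteq> H" "wf_fm p"
  shows "p \<in> H"
proof (rule maximal[OF assms(3)], rule ccontr)
  assume "\<not> consistent T (insert p H)"
  then obtain \<Delta> where "set \<Delta> \<subseteq> H" "derives T (p # \<Delta>) Fls" by (rule inconsistent_insertE)
  then have "derives T \<Delta> (Imp p Fls)" using assms(3) by (auto intro: ImpI)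
  then have "derives T (\<Gamma> @ \<Delta>) (Imp p Fls)" "derives T (\<Gamma> @ \<Delta>) p"
    using assms(1) by (auto elim: derives_weaken)
  then have "derives T (\<Gamma> @ \<Delta>) Fls" by (rule ImpE)
  with \<open>set \<Delta> \<subseteq> H\<close> assms(2) show False using inconsistentI[of "\<Gamma> @ \<Delta>"] cons by auto
qed

lemma derives_self: "set \<Gamma> \<subseteq> H \<Longrightarrow> p \<in> set \<Gamma> \<Longrightarrow> derives T \<Gamma> p"
  using wf by (auto intro: Assm)

lemma Fls_notin: "Fls \<notin> H"
  using derives_self[of "[Fls]" Fls] inconsistentI[of "[Fls]" H] cons by auto

lemma mp: "Imp p q \<in> H \<Longrightarrow> p \<in> H \<Longrightarrow> q \<in> H"
proof -
  assume *: "Imp p q \<in> H" "p \<in> H"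
  then have "derives T [Imp p q, p] q" by - (rule ImpE[of _ _ p]; auto intro: derives_self)
  moreover have "wf_fm q" using wf[OF *(1)] by simp
  ultimately show "q \<in> H" using * mem_if_derives by auto
qed

lemma mem_Neg: "wf_fm p \<Longrightarrow> Neg p \<in> H \<longleftrightarrow> p \<notin> H"
proof
  assume "wf_fm p" "p \<notin> H"
  then have "\<not> consistent T (insert p H)" using maximal by blast
  then obtain \<Delta> where "set \<Delta> \<subseteq> H" "derives T (p # \<Delta>) Fls" by (rule inconsistent_insertE)
  with \<open>wf_fm p\<close> show "Neg p \<in> H"
    by (intro mem_if_derives[of \<Delta>]) (auto simp: Neg_def intro: ImpI)
next
  show "Neg p \<in> H \<Longrightarrow> p \<notin> H" using mp Fls_notin by (auto simp: Neg_def)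
qed

lemma mem_Imp: "wf_fm p \<Longrightarrow> wf_fm q \<Longrightarrow> Imp p q \<in> H \<longleftrightarrow> (p \<in> H \<longrightarrow> q \<in> H)"
proof (intro iffI impI)
  assume wfs: "wf_fm p" "wf_fm q" and "p \<in> H \<longrightarrow> q \<in> H"
  then consider "q \<in> H" | "Neg p \<in> H" using mem_Neg by auto
  then show "Imp p q \<in> H"
  proof cases
    case 1
    then have "derives T [p, q] q" using wfs by (auto intro: Assm)
    then have "derives T [q] (Imp p q)" using wfs by (auto intro: ImpI)
    then show ?thesis using wfs 1 by (auto intro: mem_if_derives)
  next
    case 2
    have "derives T [p, Neg p] Fls" using wfs
      by - (rule ImpE[of _ _ p]; auto intro: Assm simp: Neg_def)
    then have "derives T [p, Neg p] q" using wfs by (auto intro: derives_wf_Fls)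
    then have "derives T [Neg p] (Imp p q)" using wfs by (auto intro: ImpI)
    then show ?thesis using wfs 2 by (auto intro: mem_if_derives)
  qed
qed (auto intro: mp)

lemma mem_Forall: "wf_fm q \<Longrightarrow> Forall q \<in> H \<longleftrightarrow> (\<forall>t. wf_tm t \<longrightarrow> inst q t \<in> H)"
proof (intro iffI allI impI)
  fix t assume "wf_fm q" "Forall q \<in> H" "wf_tm t"
  then have "derives T [Forall q] (inst q t)" by - (rule AllE[OF Assm]; auto)
  with \<open>wf_fm q\<close> \<open>Forall q \<in> H\<close> \<open>wf_tm t\<close> show "inst q t \<in> H"
    by (auto intro: mem_if_derives wf_inst)
next
  assume "wf_fm q" "\<forall>t. wf_tm t \<longrightarrow> inst q t \<in> H"
  then show "Forall q \<in> H" using witness[of q] mem_Neg[of "Forall q"] mem_Neg wf_inst by fastforce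
qed

lemma mem_refl: "wf_tm t \<Longrightarrow> Eq t t \<in> H"
  by (rule mem_if_derives[of "[]", OF EqI]) auto

lemma mem_replace:
  assumes "Eq s t \<in> H" "inst p s \<in> H" "wf_fm p"
  shows "inst p t \<in> H"
proof -
  have "derives T [Eq s t, inst p s] (inst p t)"
    using assms by - (rule EqE[of _ _ s t]; auto intro: derives_self)
  with assms wf[of "Eq s t"] show ?thesis by (auto intro: mem_if_derives wf_inst)
qed

lemma inst_shift [simp]: "subst_tm (case_nat t Var) (shift_tm s) = s"
  by (simp add: shift_tm_def subst_tm_subst_tm)

lemma mem_sym: "Eq s t \<in> H \<Longrightarrow> Eq t s \<in> H"
  using mem_replace[of s t "Eq (Var 0) (shift_tm s)"] mem_refl[of s] wf[of "Eq s t"]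
  by (auto simp: inst_def)

lemma mem_trans: "Eq s t \<in> H \<Longrightarrow> Eq t u \<in> H \<Longrightarrow> Eq s u \<in> H"
  using mem_replace[of t u "Eq (shift_tm s) (Var 0)"] wf[of "Eq s t"]
  by (auto simp: inst_def)

text \<open>Replacement works in one place at a time, so the arguments are exchanged from left to
  right; \<open>us\<close> collects those already exchanged.\<close>

lemma mem_App:
  assumes "list_all2 (\<lambda>s t. Eq s t \<in> H) ss ts" "has_arity (length ss) f"
  shows "Eq (App f ss) (App f ts) \<in> H"
proof -
  have "Eq (App f (us @ ss)) (App f (us @ ts)) \<in> H"
    if "has_arity (length us + length ss) f" "\<forall>t\<in>set us. wf_tm t" for us
    using assms(1) that
  proof (induction arbitrary: us rule: list_all2_induct)
    case Nil
    then show ?case by (auto intro: mem_refl)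
  next
    case (Cons s ss t ts)
    have len: "length ss = length ts" using Cons.hyps by (simp add: list_all2_lengthD)
    have wft: "wf_tm s" "wf_tm t" using wf[of "Eq s t"] Cons.hyps by auto
    have wfs: "wf_tm s" if "s \<in> set ss" for s
      using Cons.hyps(2) that wf by (fastforce simp: list_all2_conv_all_nth in_set_conv_nth)
    let ?F = "\<lambda>v. App f (map shift_tm us @ v # map shift_tm ss)"
    let ?p = "Eq (shift_tm (App f (us @ s # ss))) (?F (Var 0))"
    have inst: "inst ?p v = Eq (App f (us @ s # ss)) (App f (us @ v # ss))" for v
      by (simp add: inst_def comp_def)
    have "inst ?p t \<in> H"
    proof (rule mem_replace[OF Cons.hyps(1)])
      show "inst ?p s \<in> H" unfolding inst
        by (rule mem_refl) (use wft wfs Cons.prems in auto)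
      have "wf_tm (App f (us @ s # ss))" using wft wfs Cons.prems by auto
      then show "wf_fm ?p" using wft wfs Cons.prems by (auto simp del: subst_tm.simps)
    qed
    then have "Eq (App f (us @ s # ss)) (App f (us @ t # ss)) \<in> H" by (simp add: inst)
    moreover have "Eq (App f ((us @ [t]) @ ss)) (App f ((us @ [t]) @ ts)) \<in> H"
      by (rule Cons.IH) (use wft Cons.prems in auto)
    ultimately show ?case by (auto intro: mem_trans)
  qed
  from this[of "[]"] assms(2) show ?thesis by simp
qed

text \<open>Infinitely many classes of terms are needed because the universe is all of \<open>nat\<close>.\<close>

lemma term_model:
  assumes "\<And>p. p \<in> T \<Longrightarrow> wf_fm p"
    and distinct: "\<And>m n. m \<noteq> n \<Longrightarrow> Neg (Eq (numeral_tm m) (numeral_tm n)) \<in> H"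
  obtains I :: "code \<Rightarrow> nat list \<Rightarrow> nat" and e
  where "model T I" "\<And>p. wf_fm p \<Longrightarrow> sat I e p \<longleftrightarrow> p \<in> H"
proof -
  \<comment> \<open>A canonical representative of the class of \<open>t\<close> under equality in
    \<open>H\<close>; the choice depends on the class only.\<close>
  define rep where "rep t = (SOME s. wf_tm s \<and> Eq s t \<in> H)" for t
  have rep: "wf_tm (rep t) \<and> Eq (rep t) t \<in> H" if "wf_tm t" for t
    unfolding rep_def by (rule someI[of _ t]) (use that mem_refl in auto)
  have rep_eq: "rep s = rep t \<longleftrightarrow> Eq s t \<in> H" if "wf_tm s" "wf_tm t" for s t
  proof
    assume "rep s = rep t"
    then show "Eq s t \<in> H" using rep that by (metis mem_sym mem_trans)
  next
    assume "Eq s t \<in> H"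
    then have "Eq u s \<in> H \<longleftrightarrow> Eq u t \<in> H" for u by (metis mem_sym mem_trans)
    then show "rep s = rep t" by (simp add: rep_def)
  qed
  define R where "R = rep ` {t. wf_tm t}"
  have "inj (\<lambda>n. rep (numeral_tm n))"
    using distinct mem_Neg by (force simp: inj_def rep_eq wf_numeral_tm)
  moreover have "range (\<lambda>n. rep (numeral_tm n)) \<subseteq> R" by (auto simp: R_def wf_numeral_tm)
  ultimately have "infinite R" using finite_imageD finite_subset by blast
  then have bij: "bij_betw (from_nat_into R) UNIV R"
    by (simp add: bij_betw_from_nat_into)
  \<comment> \<open>\<open>val\<close> numbers the classes and \<open>trm\<close> names each number
    by a term. Ill-formed terms get arbitrary values, which well-formed formulas never see.\<close>
  define val where "val t = to_nat_on R (rep t)" for t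
  define trm where "trm n = from_nat_into R n" for n
  have R_wf: "wf_tm t" if "t \<in> R" for t using that rep by (auto simp: R_def)
  have wf_trm: "wf_tm (trm n)" for n
    using bij R_wf by (auto simp: trm_def bij_betw_def)
  have Rrep: "rep t \<in> R" if "wf_tm t" for t using that by (auto simp: R_def)
  have val_eq: "val s = val t \<longleftrightarrow> Eq s t \<in> H" if "wf_tm s" "wf_tm t" for s t
    using rep_eq[OF that] Rrep that by (auto simp: val_def)
  have rep_R: "rep t = t" if "t \<in> R" for t
    using that rep rep_eq unfolding R_def by fastforce
  have val_trm: "val (trm n) = n" for n
  proof -
    have "trm n \<in> R" using bij by (auto simp: trm_def bij_betw_def)
    then have "val (trm n) = to_nat_on R (trm n)" by (simp add: val_def rep_R)
    also have "\<dots> = n" using \<open>infinite R\<close> by (simp add: trm_def)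
    finally show ?thesis .
  qed
  define I where "I f xs = val (App f (map trm xs))" for f xs
  have tval: "tval I (\<lambda>i. val (\<sigma> i)) t = val (subst_tm \<sigma> t)"
    if "wf_tm t" "\<And>i. wf_tm (\<sigma> i)" for \<sigma> t
    using that(1)
  proof (induction t)
    case (App f ts)
    then have "tval I (\<lambda>i. val (\<sigma> i)) (App f ts) = I f (map (\<lambda>t. val (subst_tm \<sigma> t)) ts)"
      by (auto intro!: arg_cong[of _ _ "I f"])
    also have "\<dots> = val (App f (map (\<lambda>t. trm (val (subst_tm \<sigma> t))) ts))"
      by (simp add: I_def comp_def)
    also have "\<dots> = val (App f (map (subst_tm \<sigma>) ts))"
    proof -
      have "Eq (trm (val (subst_tm \<sigma> t))) (subst_tm \<sigma> t) \<in> H" if "t \<in> set ts" for t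
        using that App.prems \<open>\<And>i. wf_tm (\<sigma> i)\<close> val_eq[of "trm (val (subst_tm \<sigma> t))" "subst_tm \<sigma> t"]
        by (simp add: wf_trm wf_subst_tm val_trm)
      then have "Eq (App f (map (\<lambda>t. trm (val (subst_tm \<sigma> t))) ts)) (App f (map (subst_tm \<sigma>) ts)) \<in> H"
        using App.prems by (intro mem_App) (auto simp: list_all2_conv_all_nth)
      then show ?thesis using wf val_eq by fastforce
    qed
    finally show ?case by simp
  qed simp
  \<comment> \<open>The truth lemma is proved for all substitutions at once, since the quantifier
    case extends the assignment by the value of an arbitrary term.\<close>
  have sat: "sat I (\<lambda>i. val (\<sigma> i)) p \<longleftrightarrow> subst_fm \<sigma> p \<in> H"
    if "wf_fm p" "\<And>i. wf_tm (\<sigma> i)" for \<sigma> p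
    using that
  proof (induction p arbitrary: \<sigma>)
    case (Eq s t)
    then show ?case by (simp add: tval val_eq wf_subst_tm)
  next
    case Fls
    then show ?case by (simp add: Fls_notin)
  next
    case (Imp p q)
    then show ?case by (simp add: mem_Imp wf_subst_fm)
  next
    case (Forall p)
    have *: "sat I (case_nat (val t) (\<lambda>i. val (\<sigma> i))) p \<longleftrightarrow> inst (subst_fm (under_binder \<sigma>) p) t \<in> H"
      if "wf_tm t" for t
    proof -
      have "case_nat (val t) (\<lambda>i. val (\<sigma> i)) = (\<lambda>i. val (case_nat t \<sigma> i))"
        by (auto split: nat.split)
      moreover have "wf_tm (case_nat t \<sigma> i)" for i
        using that Forall.prems by (auto split: nat.split)
      ultimately show ?thesis using Forall by (simp add: inst_under_binder)
    qed
    have "sat I (\<lambda>i. val (\<sigma> i)) (Forall p) \<longleftrightarrow>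
        (\<forall>t. wf_tm t \<longrightarrow> sat I (case_nat (val t) (\<lambda>i. val (\<sigma> i))) p)"
      by (metis sat.simps(4) val_trm wf_trm)
    also have "\<dots> \<longleftrightarrow> (\<forall>t. wf_tm t \<longrightarrow> inst (subst_fm (under_binder \<sigma>) p) t \<in> H)"
      using * by auto
    also have "\<dots> \<longleftrightarrow> subst_fm \<sigma> (Forall p) \<in> H"
      using Forall.prems by (simp add: mem_Forall wf_subst_fm wf_under_binder)
    finally show ?case .
  qed
  show ?thesis
  proof
    show "model T I" unfolding model_def
    proof (intro ballI allI)
      fix p and e :: "nat \<Rightarrow> nat" assume "p \<in> T"
      then have "subst_fm (\<lambda>i. trm (e i)) p \<in> H"
        using assms(1)
        by (intro mem_if_derives[of "[]"] derives_axiom_instance) (auto simp: wf_trm wf_subst_fm)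
      then show "sat I e p"
        using sat[of p "\<lambda>i. trm (e i)"] assms(1) \<open>p \<in> T\<close> by (simp add: wf_trm val_trm)
    qed
    show "sat I (\<lambda>i. val (Var i)) p \<longleftrightarrow> p \<in> H" if "wf_fm p" for p
      using sat[of p Var] that by simp
  qed
qed

end


section \<open>Extension to a Henkin set\<close>

lemma consistent_subset: "consistent T S \<Longrightarrow> X \<subseteq> S \<Longrightarrow> consistent T X"
  unfolding consistent_def by blast

lemma consistent_subst_image:
  assumes "consistent T S" "\<And>i. wf_tm (\<tau> i)" "\<And>p. p \<in> S \<Longrightarrow> subst_fm \<tau> (subst_fm \<sigma> p) = p"
  shows "consistent T (subst_fm \<sigma> ` S)"
  unfolding consistent_def
proof (intro allI impI notI)
  fix \<Gamma> assume \<Gamma>: "set \<Gamma> \<subseteq> subst_fm \<sigma> ` S" "derives T \<Gamma> Fls"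
  then have "derives T (map (subst_fm \<tau>) \<Gamma>) (subst_fm \<tau> Fls)" using assms(2) by (intro derives_subst)
  moreover have "set (map (subst_fm \<tau>) \<Gamma>) \<subseteq> S" using \<Gamma> assms(3) by auto
  ultimately show False using assms(1) by (auto simp: consistent_def)
qed

lemma saturated_extension:
  assumes "consistent T S" "\<And>p. p \<in> S \<Longrightarrow> wf_fm p" "infinite (- (\<Union>p\<in>S. fv p))"
  obtains H where "S \<subseteq> H" "saturated T H"
proof -
  define good where "good X \<longleftrightarrow> consistent T X \<and> (\<forall>p\<in>X. wf_fm p) \<and> infinite (- (\<Union>p\<in>X. fv p))" for X
  define fresh where "fresh X = (SOME k. k \<notin> (\<Union>p\<in>X. fv p))" for X :: "fm set"
  define wit where "wit p X = {Neg (inst q (Var (fresh (insert p X)))) | q. p = Neg (Forall q)}" for p X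
  define ext where "ext X p =
    (if wf_fm p \<and> consistent T (insert p X) then insert p X \<union> wit p X else X)" for X p
  define stage where "stage = rec_nat S (\<lambda>n X. ext X (from_nat n))"
  have stage_simps: "stage 0 = S" "stage (Suc n) = ext (stage n) (from_nat n)" for n
    by (simp_all add: stage_def)
  have good_insert: "good (insert p X)" if "good X" "wf_fm p" "consistent T (insert p X)" for p X
  proof -
    have "- (\<Union>q\<in>insert p X. fv q) = - (\<Union>q\<in>X. fv q) - fv p" by auto
    with that show ?thesis by (auto simp: good_def)
  qed
  have good_ext: "good (ext X p)" if "good X" for X p
  proof (cases "wf_fm p \<and> consistent T (insert p X) \<and> (\<exists>q. p = Neg (Forall q))")
    case True
    then obtain q where q: "p = Neg (Forall q)" by blast
    have g: "good (insert p X)" using that True by (intro good_insert) auto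
    then have "\<exists>k. k \<notin> (\<Union>p\<in>insert p X. fv p)"
      unfolding good_def by (metis ComplD finite.emptyI equals0I)
    then have fr: "fresh (insert p X) \<notin> (\<Union>p\<in>insert p X. fv p)"
      unfolding fresh_def by (rule someI_ex)
    have "good (insert (Neg (inst q (Var (fresh (insert p X))))) (insert p X))"
    proof (rule good_insert[OF g])
      show "consistent T (insert (Neg (inst q (Var (fresh (insert p X))))) (insert p X))"
        by (rule consistent_insert_counterexample[OF _ _ _ fr]) (use True q in auto)
    qed (use True q in \<open>auto intro: wf_inst\<close>)
    moreover have "ext X p = insert (Neg (inst q (Var (fresh (insert p X))))) (insert p X)"
      using True q by (auto simp: ext_def wit_def Neg_def)
    ultimately show ?thesis by simp
  next
    case False
    then have "ext X p = X \<or> (wf_fm p \<and> consistent T (insert p X) \<and> ext X p = insert p X)"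
      by (auto simp: ext_def wit_def)
    with that good_insert show ?thesis by metis
  qed
  have good_stage: "good (stage n)" for n
    by (induction n) (use assms in \<open>auto simp: stage_simps good_ext good_def[of S]\<close>)
  have stage_mono: "m \<le> n \<Longrightarrow> stage m \<subseteq> stage n" for m n
    by (rule lift_Suc_mono_le[of stage]) (auto simp: stage_simps ext_def)
  define H where "H = (\<Union>n. stage n)"
  have "consistent T H"
    unfolding consistent_def
  proof (intro allI impI)
    fix \<Gamma> assume "set \<Gamma> \<subseteq> H"
    then have "\<exists>n. set \<Gamma> \<subseteq> stage n"
    proof (induction \<Gamma>)
      case (Cons p \<Gamma>)
      then obtain m n where "p \<in> stage m" "set \<Gamma> \<subseteq> stage n" by (auto simp: H_def)
      then have "set (p # \<Gamma>) \<subseteq> stage (max m n)"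
        using stage_mono[of m "max m n"] stage_mono[of n "max m n"] by auto
      then show ?case by blast
    qed simp
    then show "\<not> derives T \<Gamma> Fls" using good_stage by (auto simp: good_def consistent_def)
  qed
  \<comment> \<open>The formula \<open>p\<close> is treated at stage \<open>to_nat p\<close>; being
    consistent with the union, it is consistent with that stage.\<close>
  have added: "insert p (stage (to_nat p)) \<union> wit p (stage (to_nat p)) \<subseteq> H"
    if "wf_fm p" "consistent T (insert p H)" for p
  proof -
    have "insert p (stage (to_nat p)) \<subseteq> insert p H" by (auto simp: H_def)
    then have "stage (Suc (to_nat p)) = insert p (stage (to_nat p)) \<union> wit p (stage (to_nat p))"
      using that consistent_subset by (auto simp: stage_simps ext_def)
    then show ?thesis unfolding H_def by blast
  qed
  have "saturated T H"
  proof
    show "consistent T H" by fact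
    show "p \<in> H" if "wf_fm p" "consistent T (insert p H)" for p
      using added[OF that] by auto
    show "\<exists>t. wf_tm t \<and> Neg (inst q t) \<in> H" if "wf_fm q" "Neg (Forall q) \<in> H" for q
    proof -
      \<comment> \<open>A member of \<open>H\<close> is in particular consistent with
        \<open>H\<close>, so it is accepted at its own stage, together with its witness.\<close>
      let ?p = "Neg (Forall q)"
      have "Neg (inst q (Var (fresh (insert ?p (stage (to_nat ?p)))))) \<in> wit ?p (stage (to_nat ?p))"
        by (auto simp: wit_def)
      moreover have "wit ?p (stage (to_nat ?p)) \<subseteq> H"
        using added[of ?p] that \<open>consistent T H\<close> by (simp add: insert_absorb)
      ultimately show ?thesis by (meson subsetD wf_tm.simps(1))
    qed
    show "wf_fm p" if "p \<in> H" for p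
      using that good_stage by (auto simp: H_def good_def)
  qed
  moreover have "S \<subseteq> H" using stage_simps(1) by (auto simp: H_def)
  ultimately show ?thesis using that by blast
qed

text \<open>Renaming \<open>i \<mapsto> 2 i\<close> frees the odd variables to serve as witnesses.\<close>

theorem model_existence:
  assumes "\<And>p. p \<in> T \<Longrightarrow> wf_fm p" "\<And>p. p \<in> S \<Longrightarrow> wf_fm p" "consistent T S"
    and "\<And>m n. m \<noteq> n \<Longrightarrow> T \<turnstile> Neg (Eq (numeral_tm m) (numeral_tm n))"
  obtains I :: "code \<Rightarrow> nat list \<Rightarrow> nat" and e
  where "model T I" "\<And>p. p \<in> S \<Longrightarrow> sat I e p"
proof -
  let ?\<sigma> = "\<lambda>i. Var (2 * i)"
  have "consistent T (subst_fm ?\<sigma> ` S)"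
    by (rule consistent_subst_image[OF assms(3), of "\<lambda>i. Var (i div 2)"])
      (auto simp: subst_fm_subst_fm)
  moreover have "infinite (- (\<Union>p\<in>subst_fm ?\<sigma> ` S. fv p))"
  proof (rule infinite_super)
    show "{i. odd i} \<subseteq> - (\<Union>p\<in>subst_fm ?\<sigma> ` S. fv p)" by (auto simp: fv_subst_fm)
    have "inj (\<lambda>i::nat. 2 * i + 1)" by (auto simp: inj_def)
    then have "infinite (range (\<lambda>i::nat. 2 * i + 1))" by (simp add: finite_image_iff)
    then show "infinite {i::nat. odd i}" by (rule infinite_super[rotated]) auto
  qed
  ultimately obtain H where H: "subst_fm ?\<sigma> ` S \<subseteq> H" "saturated T H"
    using assms(2) wf_subst_fm[of _ ?\<sigma>] by (metis (no_types, lifting) imageE saturated_extension wf_tm.simps(1))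
  then interpret saturated T H by simp
  have "Neg (Eq (numeral_tm m) (numeral_tm n)) \<in> H" if "m \<noteq> n" for m n
    using assms(4)[OF that] by (intro mem_if_derives[of "[]"]) (auto simp: proves_def wf_numeral_tm)
  with assms(1) obtain I :: "code \<Rightarrow> nat list \<Rightarrow> nat" and e
    where I: "model T I" "\<And>p. wf_fm p \<Longrightarrow> sat I e p \<longleftrightarrow> p \<in> H"
    using term_model by metis
  have "sat I (\<lambda>i. e (2 * i)) p" if "p \<in> S" for p
    using I(2)[of "subst_fm ?\<sigma> p"] that H(1) assms(2) by (auto simp: sat_subst wf_subst_fm)
  with I(1) that show ?thesis by blast
qed

theorem completeness:
  assumes "\<And>p. p \<in> T \<Longrightarrow> wf_fm p"
    and "\<And>m n. m \<noteq> n \<Longrightarrow> T \<turnstile> Neg (Eq (numeral_tm m) (numeral_tm n))"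
    and "wf_fm p" "\<And>(I :: code \<Rightarrow> nat list \<Rightarrow> nat) e. model T I \<Longrightarrow> sat I e p"
  shows "T \<turnstile> p"
proof (rule ccontr)
  assume "\<not> T \<turnstile> p"
  have "consistent T {Neg p}"
    unfolding consistent_def
  proof (intro allI impI notI)
    fix \<Gamma> assume "set \<Gamma> \<subseteq> {Neg p}" "derives T \<Gamma> Fls"
    then have "derives T [Neg p] Fls" by - (rule derives_weaken, auto)
    with assms(3) have "derives T [] p" by (rule Raa)
    with \<open>\<not> T \<turnstile> p\<close> show False by (simp add: proves_def)
  qed
  then obtain I :: "code \<Rightarrow> nat list \<Rightarrow> nat" and e
    where "model T I" "\<And>q. q \<in> {Neg p} \<Longrightarrow> sat I e q"
    using model_existence[of T "{Neg p}"] assms by (metis singletonD wf_connectives(1))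
  with assms(4) show False by fastforce
qed


section \<open>Arithmetic in models of EA\<close>

lemma wf_EA: "p \<in> EA \<Longrightarrow> wf_fm p"
proof (induction rule: EA.induct)
  case (qf_induct p)
  then show ?case by (auto intro!: wf_inst wf_subst_fm split: nat.split)
qed (simp_all del: upt_Suc)

lemma qfree_connectives [simp]:
  "qfree (Neg p) \<longleftrightarrow> qfree p"
  "qfree (Or p q) \<longleftrightarrow> qfree p \<and> qfree q"
  "qfree (And p q) \<longleftrightarrow> qfree p \<and> qfree q"
  by (auto simp: Neg_def Or_def And_def)

locale EA_model =
  fixes I :: "code \<Rightarrow> 'a list \<Rightarrow> 'a"
  assumes EA: "model EA I"
begin

abbreviation "zr \<equiv> I Zero []"
abbreviation "sc x \<equiv> I Succ [x]"
abbreviation "pd x \<equiv> I Pred [x]"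
abbreviation add (infixl "[+]" 65) where "x [+] y \<equiv> I Plus [x, y]"
abbreviation sub (infixl "[-]" 65) where "x [-] y \<equiv> I Monus [x, y]"
abbreviation mul (infixl "[*]" 70) where "x [*] y \<equiv> I Times [x, y]"
definition le (infix "\<sqsubseteq>" 50) where "x \<sqsubseteq> y \<longleftrightarrow> x [-] y = zr"
definition lt (infix "\<sqsubset>" 50) where "x \<sqsubset> y \<longleftrightarrow> sc x \<sqsubseteq> y"

lemma ax: "p \<in> EA \<Longrightarrow> sat I e p"
  using EA by (auto simp: model_def)

lemma sc_neq_zr [simp]: "sc x \<noteq> zr" "zr \<noteq> sc x"
  using ax[OF EA.succ_nonzero, of "\<lambda>_. x"] by auto

lemma sc_inject [simp]: "sc x = sc y \<longleftrightarrow> x = y"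
  using ax[OF EA.succ_inj, of "case_nat x (\<lambda>_. y)"] by auto

lemma pd_simps [simp]: "pd zr = zr" "pd (sc x) = x"
  using ax[OF EA.pred_zero] ax[OF EA.pred_succ, of "\<lambda>_. x"] by simp_all

lemma add_simps [simp]: "x [+] zr = x" "x [+] sc y = sc (x [+] y)"
  using ax[OF EA.plus_zero, of "\<lambda>_. x"] ax[OF EA.plus_succ, of "case_nat x (\<lambda>_. y)"]
  by simp_all

lemma sub_simps [simp]: "x [-] zr = x" "x [-] sc y = pd (x [-] y)"
  using ax[OF EA.monus_zero, of "\<lambda>_. x"] ax[OF EA.monus_succ, of "case_nat x (\<lambda>_. y)"]
  by simp_all

lemma mul_simps [simp]: "x [*] zr = zr" "x [*] sc y = x [*] y [+] x"
  using ax[OF EA.times_zero, of "\<lambda>_. x"] ax[OF EA.times_succ, of "case_nat x (\<lambda>_. y)"]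
  by simp_all

lemma map_nth_upt: "length xs = n \<Longrightarrow> map ((!) xs) [0..<n] = xs"
  using map_nth by blast

lemma I_Proj: "i < n \<Longrightarrow> length xs = n \<Longrightarrow> I (Proj n i) xs = xs ! i"
  using ax[OF EA.proj, of i n "(!) xs"] by (simp add: comp_def map_nth_upt)

lemma I_Comp:
  "has_arity n (Comp n f gs) \<Longrightarrow> length xs = n \<Longrightarrow>
    I (Comp n f gs) xs = I f (map (\<lambda>g. I g xs) gs)"
  using ax[OF EA.comp, of n f gs "(!) xs"] by (simp add: comp_def map_nth_upt)

lemma map_case_nat_upt: "length ys = n \<Longrightarrow> map (case_nat x ((!) ys)) [Suc 0..<Suc n] = ys"
  unfolding map_Suc_upt[symmetric] by (simp add: comp_def map_nth_upt)

lemma I_BSum: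
  assumes "has_arity (Suc n) f" "length ys = n"
  shows "I (BSum f) (zr # ys) = zr"
    and "I (BSum f) (sc x # ys) = I (BSum f) (x # ys) [+] I f (x # ys)"
  using ax[OF EA.bsum_zero[OF assms(1)], of "case_nat x ((!) ys)"]
    ax[OF EA.bsum_succ[OF assms(1)], of "case_nat x ((!) ys)"]
  by (simp_all add: comp_def map_case_nat_upt[OF assms(2)] del: upt_Suc)

lemma I_BProd:
  assumes "has_arity (Suc n) f" "length ys = n"
  shows "I (BProd f) (zr # ys) = sc zr"
    and "I (BProd f) (sc x # ys) = I (BProd f) (x # ys) [*] I f (x # ys)"
  using ax[OF EA.bprod_zero[OF assms(1)], of "case_nat x ((!) ys)"]
    ax[OF EA.bprod_succ[OF assms(1)], of "case_nat x ((!) ys)"]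
  by (simp_all add: comp_def map_case_nat_upt[OF assms(2)] del: upt_Suc)

lemma qf_induction:
  assumes "wf_fm p" "qfree p" "sat I (case_nat zr e) p"
    and "\<And>x. sat I (case_nat x e) p \<Longrightarrow> sat I (case_nat (sc x) e) p"
  shows "sat I (case_nat x e) p"
proof -
  have "sat I (case_nat x e) (subst_fm (case_nat (succ_tm (Var 0)) (\<lambda>i. Var (Suc i))) p) \<longleftrightarrow>
      sat I (case_nat (sc x) e) p" for x
    unfolding sat_subst by (rule sat_cong) (auto split: nat.split)
  then show ?thesis
    using ax[OF EA.qf_induct[OF assms(1,2)], of e] assms(3,4) by (simp add: sat_inst)
qed

text \<open>Inside a model only predicates with a quantifier-free definition admit induction. Each
  use must therefore exhibit the formula, its parameters being supplied by \<open>e\<close>.\<close>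

lemma definable_induct:
  assumes "wf_fm p" "qfree p" "\<And>x. P x \<longleftrightarrow> sat I (case_nat x e) p"
    and "P zr" "\<And>x. P x \<Longrightarrow> P (sc x)"
  shows "P x"
  using qf_induction[of p e] assms by blast

lemma zr_add [simp]: "zr [+] x = x"
  by (rule definable_induct[of "Eq (App Plus [zero_tm, Var 0]) (Var 0)" _ "\<lambda>_. x"]) auto

lemma sc_add [simp]: "sc x [+] y = sc (x [+] y)"
  by (rule definable_induct[of "Eq (App Plus [succ_tm (Var 1), Var 0])
        (succ_tm (App Plus [Var 1, Var 0]))" _ "\<lambda>_. x"]) auto

lemma zr_mul [simp]: "zr [*] x = zr"
  by (rule definable_induct[of "Eq (App Times [zero_tm, Var 0]) zero_tm" _ "\<lambda>_. x"]) auto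

lemma zr_sub [simp]: "zr [-] x = zr"
  by (rule definable_induct[of "Eq (App Monus [zero_tm, Var 0]) zero_tm" _ "\<lambda>_. x"]) auto

text \<open>Naming the predecessor by \<open>pd\<close> avoids an existential quantifier, which
  would put the statement out of reach of induction.\<close>

lemma zr_or_sc: "x = zr \<or> x = sc (pd x)"
  by (rule definable_induct[of "Or (Eq (Var 0) zero_tm) (Eq (Var 0) (succ_tm (App Pred [Var 0])))"
        _ "\<lambda>_. x"]) auto

lemma sc_cases: obtains "x = zr" | y where "x = sc y"
  using zr_or_sc by blast

lemma pd_eq_zr: "pd x = zr \<longleftrightarrow> x = zr \<or> x = sc zr"
  by (cases x rule: sc_cases) auto

lemma mul_eq_zr: "x [*] y = zr \<longleftrightarrow> x = zr \<or> y = zr"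
  by (cases x rule: sc_cases; cases y rule: sc_cases) auto

lemma sc_sub_sc: "sc x [-] sc y = x [-] y"
  by (rule definable_induct[of "Eq (App Monus [succ_tm (Var 1), succ_tm (Var 0)])
        (App Monus [Var 1, Var 0])" _ "\<lambda>_. x"]) auto

lemma sub_self [simp]: "x [-] x = zr"
proof (rule definable_induct[of "Eq (App Monus [Var 0, Var 0]) zero_tm" "\<lambda>x. x [-] x = zr" "\<lambda>_. x"])
  show "y [-] y = zr \<Longrightarrow> sc y [-] sc y = zr" for y by (simp only: sc_sub_sc)
qed auto

text \<open>A disjunction in place of a hypothesis on the order, about which nothing is known yet;
  it serves to derive \<open>le_sc\<close>.\<close>

lemma sub_add_cancel: "x [-] y = zr \<or> (x [-] y) [+] y = x"
proof (rule definable_induct[of "Or (Eq (App Monus [Var 1, Var 0]) zero_tm)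
    (Eq (App Plus [App Monus [Var 1, Var 0], Var 0]) (Var 1))"
    "\<lambda>y. x [-] y = zr \<or> (x [-] y) [+] y = x" "\<lambda>_. x"])
  show "x [-] sc y = zr \<or> (x [-] sc y) [+] sc y = x"
    if "x [-] y = zr \<or> (x [-] y) [+] y = x" for y
    using that by (cases "x [-] y" rule: sc_cases) auto
qed auto

section \<open>The ordering of a model\<close>

lemma sc_le_sc [simp]: "sc x \<sqsubseteq> sc y \<longleftrightarrow> x \<sqsubseteq> y"
  by (simp add: le_def sc_sub_sc del: sub_simps)

lemma le_zr [simp]: "x \<sqsubseteq> zr \<longleftrightarrow> x = zr"
  by (simp add: le_def)

lemma zr_le [simp]: "zr \<sqsubseteq> x"
  by (simp add: le_def)

lemma le_refl [simp]: "x \<sqsubseteq> x"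
  by (simp add: le_def)

text \<open>If the predecessor of \<open>x [-] y\<close> is zero, then \<open>x [-] y\<close> is
  zero or one, and in the latter case \<open>x\<close> is \<open>sc y\<close>. This serves as the
  recursion equation of the order in later inductions on the right argument.\<close>

lemma le_sc: "x \<sqsubseteq> sc y \<longleftrightarrow> x \<sqsubseteq> y \<or> x = sc y"
proof
  assume "x \<sqsubseteq> sc y"
  then have "x [-] y = zr \<or> x [-] y = sc zr" by (simp add: le_def pd_eq_zr)
  then show "x \<sqsubseteq> y \<or> x = sc y" using sub_add_cancel[of x y] by (auto simp: le_def)
next
  assume "x \<sqsubseteq> y \<or> x = sc y"
  then show "x \<sqsubseteq> sc y" by (metis le_def le_refl pd_simps(1) sub_simps(2))
qed

lemma le_trans: "x \<sqsubseteq> y \<Longrightarrow> y \<sqsubseteq> z \<Longrightarrow> x \<sqsubseteq> z"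
proof -
  assume "x \<sqsubseteq> y"
  have "y \<sqsubseteq> z \<longrightarrow> x \<sqsubseteq> z"
    by (rule definable_induct[of "Imp (Le (Var 1) (Var 0)) (Le (Var 2) (Var 0))"
          _ "case_nat y (\<lambda>_. x)"])
      (use \<open>x \<sqsubseteq> y\<close> in \<open>auto simp: le_def[symmetric] le_sc numeral_2_eq_2 simp del: sub_simps\<close>)
  then show "y \<sqsubseteq> z \<Longrightarrow> x \<sqsubseteq> z" by simp
qed

lemma le_neq_imp_lt: "y \<sqsubseteq> x \<Longrightarrow> y = x \<or> y \<sqsubset> x"
proof -
  have "y \<sqsubseteq> x \<longrightarrow> y = x \<or> y \<sqsubset> x"
    by (rule definable_induct[of "Imp (Le (Var 1) (Var 0)) (Or (Eq (Var 1) (Var 0)) (Lt (Var 1) (Var 0)))"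
          _ "\<lambda>_. y"])
      (auto simp: lt_def le_def[symmetric] le_sc simp del: sub_simps)
  then show "y \<sqsubseteq> x \<Longrightarrow> y = x \<or> y \<sqsubset> x" by simp
qed

lemma not_sc_le: "\<not> sc x \<sqsubseteq> x"
  by (rule definable_induct[of "Neg (Lt (Var 0) (Var 0))" _ "\<lambda>_. x"])
    (auto simp: le_def[symmetric] simp del: sub_simps)

lemma le_or_lt: "x \<sqsubseteq> y \<or> y \<sqsubset> x"
proof (rule definable_induct[of "Or (Le (Var 1) (Var 0)) (Lt (Var 0) (Var 1))"
    "\<lambda>y. x \<sqsubseteq> y \<or> y \<sqsubset> x" "\<lambda>_. x"])
  show "x \<sqsubseteq> sc y \<or> sc y \<sqsubset> x" if "x \<sqsubseteq> y \<or> y \<sqsubset> x" for y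
    using that le_neq_imp_lt[of "sc y" x] by (auto simp: lt_def le_sc)
  show "x \<sqsubseteq> zr \<or> zr \<sqsubset> x" by (cases x rule: sc_cases) (auto simp: lt_def)
qed (auto simp: lt_def le_def[symmetric] simp del: sub_simps)

lemma le_antisym: "x \<sqsubseteq> y \<Longrightarrow> y \<sqsubseteq> x \<Longrightarrow> x = y"
  using le_neq_imp_lt[of x y] le_trans[of "sc x" y x] not_sc_le by (auto simp: lt_def)

sublocale linorder le lt
proof
  show "x \<sqsubset> y \<longleftrightarrow> x \<sqsubseteq> y \<and> \<not> y \<sqsubseteq> x" for x y
  proof
    assume "x \<sqsubset> y"
    then show "x \<sqsubseteq> y \<and> \<not> y \<sqsubseteq> x"
      using le_trans[of x "sc x" y] le_trans[of "sc x" y x] not_sc_le by (auto simp: lt_def le_sc)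
  next
    show "x \<sqsubseteq> y \<and> \<not> y \<sqsubseteq> x \<Longrightarrow> x \<sqsubset> y" using le_or_lt by blast
  qed
  show "x \<sqsubseteq> y \<or> y \<sqsubseteq> x" for x y
    using le_or_lt[of x y] le_trans[of y "sc y" x] by (auto simp: lt_def le_sc)
qed (auto intro: le_antisym le_trans)


end


section \<open>Terms as codes and bounded search\<close>

text \<open>\<open>BSum\<close> and \<open>BProd\<close> accept codes only, so a term in the
  variables below \<open>n\<close> has to be turned into a single \<open>n\<close>-ary function
  symbol.\<close>

fun code_of :: "nat \<Rightarrow> tm \<Rightarrow> code" where
  "code_of n (Var i) = Proj n i"
| "code_of n (App f ts) = Comp n f (map (code_of n) ts)"

lemma has_arity_code_of: "wf_tm t \<Longrightarrow> fv_tm t \<subseteq> {..<n} \<Longrightarrow> has_arity n (code_of n t)"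
  by (induction t) fastforce+

abbreviation (input) one_tm :: tm where "one_tm \<equiv> succ_tm zero_tm"

definition if_zero :: "tm \<Rightarrow> tm \<Rightarrow> tm \<Rightarrow> tm" where
  "if_zero b s t = App Plus [App Times [s, App Monus [one_tm, b]],
     App Times [t, App Monus [one_tm, App Monus [one_tm, b]]]]"

text \<open>The value is zero iff the formula holds.\<close>

primrec truth :: "fm \<Rightarrow> tm" where
  "truth (Eq s t) = App Plus [App Monus [s, t], App Monus [t, s]]"
| "truth Fls = one_tm"
| "truth (Imp p q) = App Times [App Monus [one_tm, truth p], truth q]"
| "truth (Forall p) = zero_tm"

lemma wf_truth: "wf_fm p \<Longrightarrow> wf_tm (truth p)"
  by (induction p) auto

lemma fv_truth: "qfree p \<Longrightarrow> fv_tm (truth p) = fv p"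
  by (induction p) auto

lemma wf_if_zero [simp]: "wf_tm (if_zero b s t) \<longleftrightarrow> wf_tm b \<and> wf_tm s \<and> wf_tm t"
  by (auto simp: if_zero_def)

lemma fv_if_zero [simp]: "fv_tm (if_zero b s t) = fv_tm b \<union> fv_tm s \<union> fv_tm t"
  by (auto simp: if_zero_def)

text \<open>
  On arguments \<open>w, x\<^sub>1, \<dots>, x\<^sub>n\<close>, the least \<open>i < w\<close> such that \<open>p\<close> holds of \<open>i, x\<^sub>1, \<dots>, x\<^sub>n\<close>,
  or \<open>w\<close> if there is none: the number of \<open>j < w\<close> without solution \<open>i \<le> j\<close>.
\<close>

definition no_solution :: "nat \<Rightarrow> fm \<Rightarrow> code" where
  "no_solution n p = BProd (code_of (Suc n) (truth p))"

definition least :: "nat \<Rightarrow> fm \<Rightarrow> code" where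
  "least n p = BSum (code_of (Suc n)
     (if_zero (App (no_solution n p) (succ_tm (Var 0) # map Var [1..<Suc n])) zero_tm one_tm))"

lemma has_arity_no_solution:
  "wf_fm p \<Longrightarrow> qfree p \<Longrightarrow> fv p \<subseteq> {..<Suc n} \<Longrightarrow> has_arity (Suc n) (no_solution n p)"
  by (auto simp: no_solution_def has_arity_code_of wf_truth fv_truth)

lemma has_arity_least:
  "wf_fm p \<Longrightarrow> qfree p \<Longrightarrow> fv p \<subseteq> {..<Suc n} \<Longrightarrow> has_arity (Suc n) (least n p)"
  unfolding least_def by (auto intro!: has_arity_code_of simp: has_arity_no_solution simp del: upt_Suc)

section \<open>Truth values and bounded search inside a model\<close>

context EA_model
begin

lemma I_code_of:
  "wf_tm t \<Longrightarrow> fv_tm t \<subseteq> {..<n} \<Longrightarrow> length xs = n \<Longrightarrow> I (code_of n t) xs = tval I ((!) xs) t"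
proof (induction t)
  case (App f ts)
  then have "I (code_of n (App f ts)) xs = I f (map (\<lambda>g. I g xs) (map (code_of n) ts))"
    by (metis I_Comp code_of.simps(2) has_arity_code_of)
  also have "map (\<lambda>g. I g xs) (map (code_of n) ts) = map (tval I ((!) xs)) ts"
    using App by (auto simp: SUP_le_iff)
  finally show ?case by simp
qed (simp add: I_Proj)

lemma add_eq_zr: "x [+] y = zr \<longleftrightarrow> x = zr \<and> y = zr"
  by (cases y rule: sc_cases) auto

lemma one_sub: "sc zr [-] x = (if x = zr then sc zr else zr)"
  by (cases x rule: sc_cases) (auto simp: sc_sub_sc simp del: sub_simps(2))

lemma tval_if_zero [simp]:
  "tval I e (if_zero b s t) = (if tval I e b = zr then tval I e s else tval I e t)"
  by (auto simp: if_zero_def one_sub)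

lemma tval_truth: "qfree p \<Longrightarrow> tval I e (truth p) = zr \<longleftrightarrow> sat I e p"
proof (induction p)
  case (Eq s t)
  then show ?case using le_antisym by (auto simp: add_eq_zr le_def)
qed (auto simp: mul_eq_zr one_sub)

lemma sat_params: "fv p \<subseteq> {..<Suc n} \<Longrightarrow> length ps = n \<Longrightarrow>
    sat I ((!) (x # ps)) p \<longleftrightarrow> sat I (case_nat x ((!) ps)) p"
  by (rule sat_cong) (auto simp: nth_Cons split: nat.split)

text \<open>Minimality quantifies over \<open>i\<close>, which an induction formula may not. So the
  invariant \<open>spec\<close> records only that \<open>no_solution\<close> is nonzero at the value
  found, and a second induction, \<open>no\<close>, with \<open>i\<close> as a parameter, turns this
  into the absence of smaller solutions.\<close>

lemma least_spec:
  fixes w ps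
  assumes p: "wf_fm p" "qfree p" "fv p \<subseteq> {..<Suc n}" and ps: "length ps = n"
  defines "r \<equiv> I (least n p) (w # ps)"
  shows "r \<sqsubseteq> w" and "i \<sqsubset> r \<Longrightarrow> \<not> sat I (case_nat i ((!) ps)) p"
    and "r = w \<or> sat I (case_nat r ((!) ps)) p"
proof -
  define P where "P i \<longleftrightarrow> sat I (case_nat i ((!) ps)) p" for i
  let ?g = "code_of (Suc n) (truth p)"
  let ?N = "\<lambda>w. I (no_solution n p) (w # ps)"
  let ?L = "\<lambda>w. I (least n p) (w # ps)"
  have ar: "has_arity (Suc n) ?g" "has_arity (Suc n) (no_solution n p)" "has_arity (Suc n) (least n p)"
    using p by (auto simp: has_arity_code_of wf_truth fv_truth has_arity_no_solution has_arity_least)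
  have g: "I ?g (i # ps) = zr \<longleftrightarrow> P i" for i
    using p ps sat_params[OF p(3) ps, of i]
    by (simp add: I_code_of wf_truth fv_truth tval_truth P_def)
  have N: "?N zr = sc zr" "?N (sc w) = zr \<longleftrightarrow> ?N w = zr \<or> P w" for w
    using I_BProd[OF ar(1) ps] by (auto simp: no_solution_def mul_eq_zr g)
  let ?b = "if_zero (App (no_solution n p) (succ_tm (Var 0) # map Var [1..<Suc n])) zero_tm one_tm"
  have b: "wf_tm ?b" "fv_tm ?b \<subseteq> {..<Suc n}" using ar by (auto simp del: upt_Suc)
  have args: "map (tval I ((!) (w # ps))) (map Var [1..<Suc n]) = ps" for w
    using map_case_nat_upt[OF ps, of w] by (auto simp: comp_def nth_Cons simp del: upt_Suc)
  have "I (code_of (Suc n) ?b) (w # ps) = (if ?N (sc w) = zr then zr else sc zr)" for w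
    using I_code_of[OF b, of "w # ps"] args[of w] ps by (simp del: upt_Suc map_map)
  then have L: "?L zr = zr" "?L (sc w) = (if ?N (sc w) = zr then ?L w else sc (?L w))" for w
    using I_BSum[of n "code_of (Suc n) ?b" ps] has_arity_code_of[OF b] ps by (auto simp: least_def)
  have tv: "map (tval I (case_nat w ((!) ps))) (map Var [1..<Suc n]) = ps" for w
    using map_case_nat_upt[OF ps, of w] by (simp add: comp_def del: upt_Suc)
  let ?v = "map Var [1..<Suc n]"
  have spec: "if ?N w = zr then ?L w \<sqsubset> w \<and> P (?L w) \<and> ?N (?L w) \<noteq> zr else ?L w = w" for w
  proof -
    let ?Nw = "App (no_solution n p) (Var 0 # ?v)" and ?Lw = "App (least n p) (Var 0 # ?v)"
    let ?q = "And (Imp (Eq ?Nw zero_tm) (And (Lt ?Lw (Var 0)) (And (Eq (App ?g (?Lw # ?v)) zero_tm)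
      (Neg (Eq (App (no_solution n p) (?Lw # ?v)) zero_tm)))))
      (Imp (Neg (Eq ?Nw zero_tm)) (Eq ?Lw (Var 0)))"
    let ?P = "\<lambda>w. if ?N w = zr then ?L w \<sqsubset> w \<and> P (?L w) \<and> ?N (?L w) \<noteq> zr else ?L w = w"
    show ?thesis
    proof (rule definable_induct[of ?q ?P "(!) ps"])
      show "wf_fm ?q" using ar by (auto simp del: upt_Suc)
      show "?P w \<longleftrightarrow> sat I (case_nat w ((!) ps)) ?q" for w
        using tv[of w] by (simp add: lt_def le_def g del: upt_Suc map_map)
      show "?P (sc w)" if "?P w" for w
        using that N(2)[of w] L(2)[of w] by (cases "?N w = zr") (auto simp: lt_def le_sc)
    qed (simp_all add: N L)
  qed
  have no: "?N w \<noteq> zr \<Longrightarrow> i \<sqsubset> w \<Longrightarrow> \<not> P i" for w i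
  proof -
    let ?q = "Imp (Neg (Eq (App (no_solution n p) (Var 0 # map (\<lambda>i. Var (Suc i)) [1..<Suc n])) zero_tm))
      (Imp (Lt (Var 1) (Var 0)) (Neg (Eq (App ?g (Var 1 # map (\<lambda>i. Var (Suc i)) [1..<Suc n])) zero_tm)))"
    have tv: "map (tval I (case_nat w (case_nat i ((!) ps)))) (map (\<lambda>i. Var (Suc i)) [1..<Suc n]) = ps" for w
      using map_case_nat_upt[OF ps, of i] by (simp add: comp_def del: upt_Suc)
    have "?N w \<noteq> zr \<longrightarrow> i \<sqsubset> w \<longrightarrow> \<not> P i"
    proof (rule definable_induct[of ?q "\<lambda>w. ?N w \<noteq> zr \<longrightarrow> i \<sqsubset> w \<longrightarrow> \<not> P i" "case_nat i ((!) ps)"])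
      show "wf_fm ?q" using ar by (auto simp del: upt_Suc)
      show "(?N w \<noteq> zr \<longrightarrow> i \<sqsubset> w \<longrightarrow> \<not> P i) \<longleftrightarrow> sat I (case_nat w (case_nat i ((!) ps))) ?q" for w
        using tv[of w] by (simp add: lt_def le_def g del: upt_Suc map_map)
      show "?N (sc w) \<noteq> zr \<longrightarrow> i \<sqsubset> sc w \<longrightarrow> \<not> P i"
        if "?N w \<noteq> zr \<longrightarrow> i \<sqsubset> w \<longrightarrow> \<not> P i" for w
        using that N(2)[of w] by (auto simp: lt_def le_sc)
    qed (auto simp: lt_def)
    then show "?N w \<noteq> zr \<Longrightarrow> i \<sqsubset> w \<Longrightarrow> \<not> P i" by simp
  qed
  show "r \<sqsubseteq> w" using spec[of w] by (auto simp: r_def split: if_splits)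
  show "i \<sqsubset> r \<Longrightarrow> \<not> sat I (case_nat i ((!) ps)) p"
    using spec[of w] no[of r i] no[of w i] by (auto simp: r_def P_def[symmetric] split: if_splits)
  show "r = w \<or> sat I (case_nat r ((!) ps)) p"
    using spec[of w] by (auto simp: r_def P_def split: if_splits)
qed

end


section \<open>Models of EA\<close>

text \<open>This must be done by derivations: distinct numerals are what makes term models infinite,
  and so are a hypothesis of the completeness theorem itself.\<close>

lemma derives_numeral_neq:
  "derives EA \<Gamma> (Eq (numeral_tm m) (numeral_tm n)) \<Longrightarrow> m \<noteq> n \<Longrightarrow> derives EA \<Gamma> Fls"
proof (induction m arbitrary: n)
  have zero: "derives EA \<Gamma> Fls" if "derives EA \<Gamma> (Eq (numeral_tm (Suc k)) zero_tm)" for k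
  proof -
    have "derives EA \<Gamma> (Neg (Eq (numeral_tm (Suc k)) zero_tm))"
      using derives_axiom_instance[OF EA.succ_nonzero, of "\<lambda>_. numeral_tm k" \<Gamma>] by (simp add: wf_numeral_tm)
    then show ?thesis using that unfolding Neg_def by (rule ImpE)
  qed
  {
    case 0
    then obtain k where [simp]: "n = Suc k" by (cases n) auto
    \<comment> \<open>Replacing the first zero in \<open>0 = 0\<close> reverses the
      equation.\<close>
    let ?p = "Eq (Var 0) zero_tm"
    have "derives EA \<Gamma> (inst ?p (numeral_tm n))"
      by (rule EqE[OF 0(1)]) (auto simp: inst_def intro: EqI)
    then show ?case using zero[of k] by (simp add: inst_def)
  next
    case (Suc m)
    show ?case
    proof (cases n)
      case 0
      then show ?thesis using zero[of m] Suc.prems by simp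
    next
      case (Suc k)
      have "derives EA \<Gamma> (Imp (Eq (numeral_tm (Suc m)) (numeral_tm (Suc k)))
          (Eq (numeral_tm m) (numeral_tm k)))"
        using derives_axiom_instance[OF EA.succ_inj, of "case_nat (numeral_tm m) (\<lambda>_. numeral_tm k)" \<Gamma>]
        by (auto simp: wf_numeral_tm split: nat.split)
      then have "derives EA \<Gamma> (Eq (numeral_tm m) (numeral_tm k))"
        using Suc.prems Suc by (auto intro: ImpE)
      then show ?thesis using Suc.IH Suc Suc.prems by auto
    qed
  }
qed

lemma EA_numeral_neq: "m \<noteq> n \<Longrightarrow> EA \<turnstile> Neg (Eq (numeral_tm m) (numeral_tm n))"
proof -
  assume "m \<noteq> n"
  show ?thesis
    unfolding proves_def Neg_def
    by (intro ImpI derives_numeral_neq[OF Assm \<open>m \<noteq> n\<close>]) auto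
qed

lemma EA_model_existence:
  assumes "\<And>p. p \<in> S \<Longrightarrow> wf_fm p" "consistent EA S"
  obtains I :: "code \<Rightarrow> nat list \<Rightarrow> nat" and e
  where "model EA I" "\<And>p. p \<in> S \<Longrightarrow> sat I e p"
  by (rule model_existence[of EA S]) (use assms wf_EA EA_numeral_neq that in auto)

lemma EA_completeness:
  assumes "wf_fm p" "\<And>(I :: code \<Rightarrow> nat list \<Rightarrow> nat) e. model EA I \<Longrightarrow> sat I e p"
  shows "EA \<turnstile> p"
  by (rule completeness) (use assms wf_EA EA_numeral_neq in auto)

text \<open>Soundness in the standard model turns the provable bounds on \<open>f\<close> and
  \<open>h\<close> into statements about the functions on \<omega>.\<close>

lemma model_denote: "model EA denote"
  unfolding model_def
proof (intro ballI allI)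
  fix p and e :: "nat \<Rightarrow> nat" assume "p \<in> EA"
  then show "sat denote e p"
  proof cases
    case (qf_induct q)
    have "sat denote (case_nat x e) (subst_fm (case_nat (succ_tm (Var 0)) (\<lambda>i. Var (Suc i))) q) \<longleftrightarrow>
        sat denote (case_nat (Suc x) e) q" for x
      unfolding sat_subst by (rule sat_cong) (auto split: nat.split)
    moreover have "sat denote (case_nat x e) q"
      if "sat denote (case_nat 0 e) q"
        "\<And>x. sat denote (case_nat x e) q \<Longrightarrow> sat denote (case_nat (Suc x) e) q" for x
      using that by (induction x) auto
    ultimately show ?thesis using qf_induct by (auto simp: sat_inst)
  qed (auto simp: comp_def simp del: upt_Suc)
qed

text \<open>
  All axioms but induction are universal, and a counterexample to induction in a substructure
  yields a least one in the large model, which is a term in the parameters and hence lies in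
  the substructure.
\<close>

lemma (in EA_model) model_substructure:
  fixes \<phi> :: "'b \<Rightarrow> 'a"
  assumes "inj \<phi>" and closed: "\<And>f xs. has_arity (length xs) f \<Longrightarrow> I f (map \<phi> xs) \<in> range \<phi>"
  defines "J \<equiv> \<lambda>f xs. inv \<phi> (I f (map \<phi> xs))"
  shows "model EA J" "\<And>e p. wf_fm p \<Longrightarrow> qfree p \<Longrightarrow> sat J e p \<longleftrightarrow> sat I (\<lambda>i. \<phi> (e i)) p"
proof -
  have J: "\<phi> (J f xs) = I f (map \<phi> xs)" if "has_arity (length xs) f" for f xs
    using closed[OF that] by (simp add: J_def f_inv_into_f)
  have tval_J: "\<phi> (tval J e t) = tval I (\<lambda>i. \<phi> (e i)) t" if "wf_tm t" for e t
    using that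
  proof (induction t)
    case (App f ts)
    then have "map (\<lambda>t. \<phi> (tval J e t)) ts = map (tval I (\<lambda>i. \<phi> (e i))) ts" by auto
    with App.prems show ?case by (simp add: J comp_def del: map_eq_conv)
  qed simp
  show sat_J: "sat J e p \<longleftrightarrow> sat I (\<lambda>i. \<phi> (e i)) p" if "wf_fm p" "qfree p" for e p
    using that
  proof (induction p)
    case (Eq s t)
    have "tval J e s = tval J e t \<longleftrightarrow> \<phi> (tval J e s) = \<phi> (tval J e t)"
      using \<open>inj \<phi>\<close> by (auto dest: injD)
    with Eq show ?case by (simp add: tval_J)
  qed auto
  have case_nat_\<phi>: "(\<lambda>i. \<phi> (case_nat x e i)) = case_nat (\<phi> x) (\<lambda>i. \<phi> (e i))" for x e
    by (auto split: nat.split)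
  show "model EA J"
    unfolding model_def
  proof (intro ballI allI)
    fix p and e :: "nat \<Rightarrow> 'b" assume "p \<in> EA"
    then have "qfree p \<or> (\<exists>q. wf_fm q \<and> qfree q \<and> p = Imp (inst q zero_tm)
        (Imp (Forall (Imp q (subst_fm (case_nat (succ_tm (Var 0)) (\<lambda>i. Var (Suc i))) q))) (Forall q)))"
      by cases auto
    then consider "qfree p" | q where "wf_fm q" "qfree q" "p = Imp (inst q zero_tm)
        (Imp (Forall (Imp q (subst_fm (case_nat (succ_tm (Var 0)) (\<lambda>i. Var (Suc i))) q))) (Forall q))"
      by blast
    then show "sat J e p"
    proof cases
      case 1
      then show ?thesis using sat_J wf_EA ax \<open>p \<in> EA\<close> by blast
    next
      case 2
      have succ: "sat J (case_nat x e) (subst_fm (case_nat (succ_tm (Var 0)) (\<lambda>i. Var (Suc i))) q) \<longleftrightarrow>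
          sat J (case_nat (J Succ [x]) e) q" for x
        unfolding sat_subst by (rule sat_cong) (auto split: nat.split)
      have "sat J (case_nat a e) q"
        if zero: "sat J (case_nat (J Zero []) e) q"
          and step: "\<And>x. sat J (case_nat x e) q \<Longrightarrow> sat J (case_nat (J Succ [x]) e) q" for a
      proof (rule ccontr)
        assume a: "\<not> sat J (case_nat a e) q"
        obtain n where n: "\<And>i. i \<in> fv q \<Longrightarrow> i < n"
          using finite_nat_set_iff_bounded[of "fv q"] by auto
        then have fv: "fv (Neg q) \<subseteq> {..<Suc n}" by force
        define ps where "ps = map (\<lambda>i. \<phi> (e i)) [0..<n]"
        have ps: "length ps = n" by (simp add: ps_def)
        have sat_ps: "sat I (case_nat (\<phi> x) ((!) ps)) (Neg q) \<longleftrightarrow> \<not> sat J (case_nat x e) q" for x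
        proof -
          have "sat I (case_nat (\<phi> x) ((!) ps)) q \<longleftrightarrow> sat I (case_nat (\<phi> x) (\<lambda>i. \<phi> (e i))) q"
            by (rule sat_cong) (use n in \<open>force simp: ps_def split: nat.split\<close>)
          with 2 show ?thesis by (simp add: sat_J case_nat_\<phi>)
        qed
        have wf: "wf_fm (Neg q)" "qfree (Neg q)" using 2 by auto
        let ?xs = "J Succ [a] # map e [0..<n]"
        \<comment> \<open>The bound is one above the failure \<open>a\<close>, so the search for a
          failure of \<open>q\<close> succeeds.\<close>
        define r where "r = I (least n (Neg q)) (sc (\<phi> a) # ps)"
        note r = least_spec[OF wf fv ps, where w = "sc (\<phi> a)", folded r_def]
        have "r = I (least n (Neg q)) (map \<phi> ?xs)"
          by (simp add: r_def ps_def J comp_def)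
        then have "r \<in> range \<phi>" using closed[of ?xs] has_arity_least[OF wf fv] by simp
        then obtain b where b: "r = \<phi> b" by auto
        have "r \<noteq> sc (\<phi> a)" using r(2)[of "\<phi> a"] a by (auto simp: sat_ps lt_def simp del: sat_connectives)
        then have "\<not> sat J (case_nat b e) q" using r(3) by (simp add: sat_ps b del: sat_connectives)
        \<comment> \<open>The least failure is not zero, so it has a predecessor, which lies in the
          substructure as a value of \<open>Pred\<close>. There \<open>q\<close> holds by
          minimality, and \<open>step\<close> carries it to \<open>b\<close>.\<close>
        then have "b \<noteq> J Zero []" using zero by auto
        then have "r \<noteq> zr" using J[of "[]" Zero] injD[OF \<open>inj \<phi>\<close>, of b "J Zero []"] b by auto
        then obtain y where y: "r = sc y" using zr_or_sc[of r] by blast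
        then have "y = \<phi> (J Pred [b])" using J[of "[b]" Pred] b[symmetric] by simp
        moreover from this have "sat J (case_nat (J Pred [b]) e) q"
          using r(2)[of y] y by (auto simp: lt_def sat_ps simp del: sat_connectives)
        then have "sat J (case_nat (J Succ [J Pred [b]]) e) q" by (rule step)
        moreover have "J Succ [J Pred [b]] = b"
          using J[of "[J Pred [b]]" Succ] calculation(1) y b injD[OF \<open>inj \<phi>\<close>, of "J Succ [J Pred [b]]" b]
          by auto
        ultimately show False using \<open>\<not> sat J (case_nat b e) q\<close> by simp
      qed
      then show ?thesis using 2 by (auto simp: sat_inst succ)
    qed
  qed
qed


section \<open>Herbrand witnesses\<close>

abbreviation env3 :: "'a \<Rightarrow> 'a \<Rightarrow> 'a \<Rightarrow> nat \<Rightarrow> 'a" where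
  "env3 y v c \<equiv> case_nat y (case_nat v (\<lambda>_. c))"

lemma sat_env3:
  "fv p \<subseteq> {0, 1, 2} \<Longrightarrow> sat I (case_nat y (case_nat v e)) p \<longleftrightarrow> sat I (env3 y v (e 0)) p"
  by (rule sat_cong) (auto simp: numeral_2_eq_2)

definition counterexample :: "fm \<Rightarrow> tm \<Rightarrow> tm \<Rightarrow> tm \<Rightarrow> fm" where
  "counterexample p y v c = Neg (subst_fm (case_nat y (case_nat v (\<lambda>_. c))) p)"

lemma sat_counterexample:
  "sat I e (counterexample p y v c) \<longleftrightarrow> \<not> sat I (env3 (tval I e y) (tval I e v) (tval I e c)) p"
  unfolding counterexample_def sat_connectives sat_subst
  by (intro arg_cong[of _ _ Not] sat_cong) (auto split: nat.split)

lemma wf_counterexample: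
  "wf_fm p \<Longrightarrow> wf_tm y \<Longrightarrow> wf_tm v \<Longrightarrow> wf_tm c \<Longrightarrow> wf_fm (counterexample p y v c)"
  by (auto simp: counterexample_def intro!: wf_subst_fm split: nat.split)

text \<open>
  If no finite list of candidates works, then EA is consistent with each term \<open>t i\<close> in the
  parameter \<open>x\<^sub>0\<close> and the counterexamples \<open>x\<^sub>1, \<dots>, x\<^sub>i\<close> to its predecessors having
  the counterexample \<open>x\<^bsub>i+1\<^esub>\<close>; the values of terms in a model of this form a
  substructure where the \<open>\<exists>\<forall>\<close> statement fails.
\<close>

lemma herbrand_candidates:
  fixes C :: "bool \<Rightarrow> fm"
  assumes C: "\<And>b. qf_matrix (C b)"
    and valid: "\<And>(I :: code \<Rightarrow> nat list \<Rightarrow> nat) c. model EA I \<Longrightarrow> \<exists>b v. \<forall>y. sat I (env3 y v c) (C b)"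
  obtains L :: "(bool \<times> code) list"
  where "\<And>i. i < length L \<Longrightarrow> has_arity (Suc i) (snd (L ! i))"
    and "\<And>(I :: code \<Rightarrow> nat list \<Rightarrow> nat) c d. model EA I \<Longrightarrow>
      \<exists>i<length L. sat I (env3 (d i) (I (snd (L ! i)) (c # map d [0..<i])) c) (C (fst (L ! i)))"
proof -
  \<comment> \<open>An enumeration of tagged terms whose entry \<open>i\<close> uses only variables
    up to \<open>i\<close>. The second component of \<open>prod_decode\<close> makes every pair
    recur, so it also occurs at an index large enough for its variables; unsuitable entries are
    filled by a default.\<close>
  define t :: "nat \<Rightarrow> bool \<times> tm" where
    "t i = (let q = from_nat (fst (prod_decode i)) in
      if wf_tm (snd q) \<and> fv_tm (snd q) \<subseteq> {..i} then q else (True, Var 0))" for i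
  have t: "wf_tm (snd (t i))" "fv_tm (snd (t i)) \<subseteq> {..i}" for i
    by (auto simp: t_def Let_def split: if_splits)
  have t_surj: "\<exists>i. t i = (b, s)" if s: "wf_tm s" for b s
  proof -
    obtain n where n: "\<And>i. i \<in> fv_tm s \<Longrightarrow> i < n"
      using finite_nat_set_iff_bounded[of "fv_tm s"] by auto
    then have "fv_tm s \<subseteq> {..prod_encode (to_nat (b, s), n)}"
      using le_prod_encode_2[of n "to_nat (b, s)"] by fastforce
    with s have "t (prod_encode (to_nat (b, s), n)) = (b, s)" by (simp add: t_def)
    then show ?thesis by blast
  qed
  \<comment> \<open>Variable 0 is the parameter, and variable \<open>Suc i\<close> is the
    counterexample to candidate \<open>i\<close>, new to all candidates up to
    \<open>i\<close>.\<close>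
  define \<psi> where "\<psi> i = counterexample (C (fst (t i))) (Var (Suc i)) (snd (t i)) (Var 0)" for i
  have wf_\<psi>: "wf_fm (\<psi> i)" for i
    using C t by (auto simp: \<psi>_def qf_matrix_def intro!: wf_counterexample)
  have "\<not> consistent EA (range \<psi>)"
  proof
    assume "consistent EA (range \<psi>)"
    moreover have "wf_fm p" if "p \<in> range \<psi>" for p using that wf_\<psi> by auto
    ultimately obtain I :: "code \<Rightarrow> nat list \<Rightarrow> nat" and e
      where I: "model EA I" and "\<And>p. p \<in> range \<psi> \<Longrightarrow> sat I e p"
      using EA_model_existence[of "range \<psi>"] by metis
    then have sat_\<psi>: "sat I e (\<psi> i)" for i by auto
    from I interpret EA_model I by unfold_locales
    define D where "D = {tval I e s | s. wf_tm s}"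
    have I_D: "I f xs \<in> D" if f: "has_arity (length xs) f" and xs: "set xs \<subseteq> D" for f xs
    proof -
      have "\<forall>x\<in>D. \<exists>s. wf_tm s \<and> x = tval I e s" by (auto simp: D_def)
      then obtain s where s: "\<And>x. x \<in> D \<Longrightarrow> wf_tm (s x) \<and> x = tval I e (s x)" by metis
      then have "map (\<lambda>x. tval I e (s x)) xs = xs" using xs by (intro map_idI) auto
      then have "I f xs = tval I e (App f (map s xs))" by (simp add: comp_def)
      moreover have "wf_tm (App f (map s xs))" using f s xs by auto
      ultimately show ?thesis unfolding D_def by blast
    qed
    have zr_D: "zr \<in> D" by (rule I_D) auto
    have sc_D: "(\<lambda>x. sc x) ` D \<subseteq> D" by (auto intro!: I_D)
    \<comment> \<open>\<open>valid\<close> speaks of universes \<open>nat\<close> only. Successor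
      maps \<open>D\<close> injectively into itself and misses zero.\<close>
    have "infinite D"
    proof
      assume "finite D"
      then have "(\<lambda>x. sc x) ` D = D"
        using sc_D by (intro endo_inj_surj) (auto simp: inj_on_def)
      with zr_D have "zr \<in> (\<lambda>x. sc x) ` D" by simp
      then show False by auto
    qed
    define \<phi> where "\<phi> = from_nat_into D"
    have \<phi>: "inj \<phi>" "range \<phi> = D"
      using bij_betw_from_nat_into[of D] \<open>infinite D\<close> by (auto simp: \<phi>_def bij_betw_def)
    have closed: "I f (map \<phi> xs) \<in> range \<phi>" if "has_arity (length xs) f" for f xs
      unfolding \<phi>(2) by (rule I_D) (use that \<phi>(2) in auto)
    define J where "J f xs = inv \<phi> (I f (map \<phi> xs))" for f xs
    note J = model_substructure[OF \<phi>(1) closed, folded J_def]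
    have "e 0 \<in> range \<phi>" using \<phi>(2) by (auto simp: D_def intro!: exI[of _ "Var 0"])
    then obtain c where c: "e 0 = \<phi> c" by auto
    obtain b v where bv: "\<And>y. sat J (env3 y v c) (C b)" using valid[OF J(1)] by blast
    obtain s where s: "wf_tm s" "\<phi> v = tval I e s" using \<phi>(2) unfolding D_def by blast
    \<comment> \<open>The witness \<open>v\<close> is the value of a term, which was enumerated as
      some candidate; the counterexample \<open>e (Suc i)\<close> to it also lies in the
      substructure.\<close>
    obtain i where i: "t i = (b, s)" using t_surj s by blast
    have "e (Suc i) \<in> range \<phi>" using \<phi>(2) by (auto simp: D_def intro!: exI[of _ "Var (Suc i)"])
    then obtain y where y: "e (Suc i) = \<phi> y" by auto
    have "(\<lambda>j. \<phi> (env3 y v c j)) = env3 (\<phi> y) (\<phi> v) (\<phi> c)" by (auto split: nat.split)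
    then have "sat I (env3 (\<phi> y) (\<phi> v) (\<phi> c)) (C b)"
      using bv[of y] J(2)[of "C b"] C by (auto simp: qf_matrix_def)
    with sat_\<psi>[of i] show False by (simp add: \<psi>_def sat_counterexample i c y s)
  qed
  then obtain \<Gamma> where \<Gamma>: "set \<Gamma> \<subseteq> range \<psi>" "derives EA \<Gamma> Fls" by (auto simp: consistent_def)
  then obtain K where K: "finite K" "set \<Gamma> = \<psi> ` K"
    by (metis finite_subset_image finite_set)
  then obtain n where n: "\<And>i. i \<in> K \<Longrightarrow> i < n"
    using finite_nat_set_iff_bounded[of K] by auto
  \<comment> \<open>All indices below a bound are kept, whether used in the refutation or not, so
    that candidate \<open>i\<close> has as its arguments \<open>c\<close> and exactly the
    \<open>i\<close> earlier counterexamples.\<close>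
  define L where "L = map (\<lambda>i. (fst (t i), code_of (Suc i) (snd (t i)))) [0..<n]"
  show ?thesis
  proof
    have fv_t: "fv_tm (snd (t i)) \<subseteq> {..<Suc i}" for i using t(2)[of i] by auto
    show "has_arity (Suc i) (snd (L ! i))" if "i < length L" for i
      using that t fv_t by (auto simp: L_def has_arity_code_of)
    fix I :: "code \<Rightarrow> nat list \<Rightarrow> nat" and c :: nat and d :: "nat \<Rightarrow> nat" assume "model EA I"
    then interpret EA_model I by unfold_locales
    let ?e = "case_nat c d"
    have "\<exists>i\<in>K. \<not> sat I ?e (\<psi> i)"
    proof (rule ccontr)
      assume "\<not> ?thesis"
      then have "sat I ?e Fls" using derives_sound[OF \<Gamma>(2) EA] K by auto
      then show False by simp
    qed
    then obtain i where i: "i < n" "\<not> sat I ?e (\<psi> i)" using n by blast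
    have "I (code_of (Suc i) (snd (t i))) (c # map d [0..<i]) = tval I ((!) (c # map d [0..<i])) (snd (t i))"
      using t fv_t by (intro I_code_of) auto
    also have "\<dots> = tval I ?e (snd (t i))"
      by (rule tval_cong) (use t(2)[of i] in \<open>force simp: nth_Cons split: nat.split\<close>)
    finally show "\<exists>i<length L. sat I (env3 (d i) (I (snd (L ! i)) (c # map d [0..<i])) c) (C (fst (L ! i)))"
      using i by (intro exI[of _ i]) (auto simp: L_def \<psi>_def sat_counterexample)
  qed
qed


section \<open>The descent\<close>

context EA_model
begin

abbreviation num :: "nat \<Rightarrow> 'a" where "num k \<equiv> ((\<lambda>x. sc x) ^^ k) zr"

lemma tval_numeral_tm [simp]: "tval I e (numeral_tm k) = num k"
  by (induction k) auto

lemma less_sc: "x \<sqsubset> sc y \<longleftrightarrow> x \<sqsubseteq> y"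
  by (simp add: lt_def)

text \<open>A solution found below \<open>w\<close> is also found with the larger bound, and each of
  the two values is least, hence at most the other. This keeps the descent from ever returning to a
  refuted candidate.\<close>

lemma least_stable:
  assumes p: "wf_fm p" "qfree p" "fv p \<subseteq> {..<Suc n}" and ps: "length ps = n"
    and "I (least n p) (w # ps) \<sqsubset> w" "w \<sqsubseteq> w'"
  shows "I (least n p) (w' # ps) = I (least n p) (w # ps)"
proof -
  note w = least_spec[OF p ps, where w = w] and w' = least_spec[OF p ps, where w = w']
  have w_found: "sat I (case_nat (I (least n p) (w # ps)) ((!) ps)) p" using w(3) assms(5) by auto
  then have le: "I (least n p) (w' # ps) \<sqsubseteq> I (least n p) (w # ps)"
    using w'(2) not_le by blast
  then have "I (least n p) (w' # ps) \<noteq> w'" using assms(5,6) by (metis leD le_trans)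
  then have "sat I (case_nat (I (least n p) (w' # ps)) ((!) ps)) p" using w'(3) by auto
  then have "I (least n p) (w # ps) \<sqsubseteq> I (least n p) (w' # ps)" using w(2) not_le by blast
  with le show ?thesis by (intro le_antisym)
qed

end

section \<open>Codes for the descent\<close>

definition bit_tm :: "bool \<Rightarrow> tm" where
  "bit_tm b = (if b then one_tm else zero_tm)"

lemma bit_tm_simps [simp]: "wf_tm (bit_tm b)" "fv_tm (bit_tm b) = {}"
  by (auto simp: bit_tm_def)

lemma fv_numeral_tm [simp]: "fv_tm (numeral_tm k) = {}"
  by (induction k) auto

lemma fv_counterexample:
  "fv (counterexample p y v c) \<subseteq> fv_tm y \<union> fv_tm v \<union> fv_tm c"
  by (auto simp: counterexample_def fv_subst_fm split: nat.splits)

lemma qfree_subst_fm [simp]: "qfree (subst_fm \<sigma> p) \<longleftrightarrow> qfree p"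
  by (induction p) auto

lemma qfree_counterexample [simp]: "qfree (counterexample p y v c) \<longleftrightarrow> qfree p"
  by (simp add: counterexample_def)

text \<open>Variable 0 is left to the bounded search. The arguments of the candidate are variables 1
  to \<open>m\<close>, the first of them being \<open>c\<close>.\<close>

definition refutes :: "nat \<Rightarrow> fm \<Rightarrow> code \<Rightarrow> fm" where
  "refutes m p g = counterexample p (Var 0) (App g (map Var [1..<Suc m])) (Var 1)"

text \<open>
  The arguments are a stage \<open>w\<close>, the parameter \<open>c\<close> and the counterexamples found so far.
  The value is that of the first remaining candidate without a counterexample below \<open>w\<close>.
\<close>

fun descend :: "(bool \<Rightarrow> fm) \<Rightarrow> (bool \<Rightarrow> nat \<Rightarrow> tm) \<Rightarrow> nat \<Rightarrow> (bool \<times> code) list \<Rightarrow> code" where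
  "descend C val m [] = code_of (Suc m) zero_tm"
| "descend C val m ((b, g) # L) = code_of (Suc m)
     (let d = App (least m (refutes m (C b) g)) (map Var [0..<Suc m])
      in if_zero (App Monus [succ_tm d, Var 0])
           (App (descend C val (Suc m) L) (map Var [0..<Suc m] @ [d])) (val b (length L)))"

text \<open>One recursion with two outputs keeps \<open>f\<close> and \<open>h\<close> at the same
  candidate.\<close>

definition kind :: "(bool \<Rightarrow> fm) \<Rightarrow> nat \<Rightarrow> (bool \<times> code) list \<Rightarrow> code" where
  "kind C = descend C (\<lambda>b k. bit_tm b)"

text \<open>The current candidate counts as left, hence \<open>Suc k\<close> if \<open>k\<close>
  others follow. The exhausted list has rank 0, so passing over the last candidate lowers the rank
  too.\<close>

definition rank :: "(bool \<Rightarrow> fm) \<Rightarrow> nat \<Rightarrow> (bool \<times> code) list \<Rightarrow> code" where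
  "rank C = descend C (\<lambda>b k. numeral_tm (Suc k))"

text \<open>Arities grow by one along the list, since each refuted candidate hands its
  counterexample to the rest.\<close>

fun candidates :: "nat \<Rightarrow> (bool \<times> code) list \<Rightarrow> bool" where
  "candidates m [] \<longleftrightarrow> True"
| "candidates m ((b, g) # L) \<longleftrightarrow> has_arity m g \<and> candidates (Suc m) L"

lemma candidatesI: "(\<And>i. i < length L \<Longrightarrow> has_arity (m + i) (snd (L ! i))) \<Longrightarrow> candidates m L"
proof (induction m L rule: candidates.induct)
  case (2 m b g L)
  have "has_arity (Suc m + i) (snd (L ! i))" if "i < length L" for i
    using 2(2)[of "Suc i"] that by simp
  then show ?case using 2(1) 2(2)[of 0] by simp
qed simp

locale matrices =
  fixes C :: "bool \<Rightarrow> fm" and val :: "bool \<Rightarrow> nat \<Rightarrow> tm"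
  assumes C: "qf_matrix (C b)"
    and val: "wf_tm (val b k)" "fv_tm (val b k) = {}"
begin

lemma refutes:
  assumes "has_arity m g" "0 < m"
  shows "wf_fm (refutes m (C b) g)" "qfree (refutes m (C b) g)" "fv (refutes m (C b) g) \<subseteq> {..<Suc m}"
proof -
  show "wf_fm (refutes m (C b) g)" "qfree (refutes m (C b) g)"
    using assms C[of b] by (auto simp: refutes_def qf_matrix_def intro!: wf_counterexample simp del: upt_Suc)
  show "fv (refutes m (C b) g) \<subseteq> {..<Suc m}"
    unfolding refutes_def by (rule order_trans[OF fv_counterexample]) (use assms in auto)
qed

lemma has_arity_descend: "candidates m L \<Longrightarrow> 0 < m \<Longrightarrow> has_arity (Suc m) (descend C val m L)"
proof (induction m L rule: candidates.induct)
  case (1 m)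
  then show ?case by simp
next
  case (2 m b g L)
  then have "has_arity m g" by simp
  note q = refutes[OF this 2(3), of b]
  show ?case
    unfolding descend.simps Let_def
    by (rule has_arity_code_of) (use 2 has_arity_least[OF q] val in \<open>auto simp del: upt_Suc\<close>)
qed

end

section \<open>The descent inside a model\<close>

context EA_model
begin

lemma descend_Nil: "length xs = m \<Longrightarrow> I (descend C val m []) (w # xs) = zr"
  using I_code_of[of zero_tm "Suc m" "w # xs"] by simp

lemma descend_Cons:
  fixes b w
  assumes "matrices C val" "has_arity m g" "candidates (Suc m) L" "0 < m" "length xs = m"
  defines "d \<equiv> I (least m (refutes m (C b) g)) (w # xs)"
  shows "I (descend C val m ((b, g) # L)) (w # xs) =
    (if d \<sqsubset> w then I (descend C val (Suc m) L) (w # xs @ [d]) else tval I e (val b (length L)))"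
proof -
  interpret matrices C val by fact
  note q = refutes[OF assms(2,4), of b]
  have args: "map (tval I ((!) (w # xs))) (map Var [0..<Suc m]) = w # xs"
    using assms(5) map_nth_upt[of "w # xs" "Suc m"] by (simp add: comp_def del: upt_Suc)
  have "tval I e' (val b (length L)) = tval I e (val b (length L))" for e'
    by (rule tval_cong) (simp add: val)
  then show ?thesis
    unfolding descend.simps Let_def
    by (subst I_code_of)
      (use assms has_arity_least[OF q] has_arity_descend[of "Suc m" L] val args
        in \<open>auto simp: lt_def le_def simp del: upt_Suc map_map\<close>)
qed

lemma sat_refutes:
  assumes "length xs = m" "0 < m"
  shows "sat I (case_nat y ((!) xs)) (refutes m p g) \<longleftrightarrow> \<not> sat I (env3 y (I g xs) (xs ! 0)) p"
proof -
  have "map (tval I (case_nat y ((!) xs))) (map Var [1..<Suc m]) = xs"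
    using map_case_nat_upt[OF assms(1), of y] by (simp add: comp_def del: upt_Suc)
  then show ?thesis
    unfolding refutes_def sat_counterexample by (simp del: upt_Suc map_map)
qed

abbreviation "bool_val b \<equiv> if b then sc zr else zr"

context
  fixes C :: "bool \<Rightarrow> fm"
  assumes C: "\<And>b. qf_matrix (C b)"
begin

lemma matrices_kind: "matrices C (\<lambda>b k. bit_tm b)"
  by unfold_locales (auto simp: C)

lemma matrices_rank: "matrices C (\<lambda>b k. numeral_tm (Suc k))"
  by unfold_locales (auto simp: C)

lemma kind_Cons:
  assumes "has_arity m g" "candidates (Suc m) L" "0 < m" "length xs = m"
    "d = I (least m (refutes m (C b) g)) (w # xs)"
  shows "I (kind C m ((b, g) # L)) (w # xs) =
    (if d \<sqsubset> w then I (kind C (Suc m) L) (w # xs @ [d]) else bool_val b)"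
  unfolding kind_def descend_Cons[OF matrices_kind assms(1-4), where e = "\<lambda>_. zr"] assms(5)
  by (simp add: bit_tm_def)

lemma rank_Cons:
  assumes "has_arity m g" "candidates (Suc m) L" "0 < m" "length xs = m"
    "d = I (least m (refutes m (C b) g)) (w # xs)"
  shows "I (rank C m ((b, g) # L)) (w # xs) =
    (if d \<sqsubset> w then I (rank C (Suc m) L) (w # xs @ [d]) else num (Suc (length L)))"
  unfolding rank_def descend_Cons[OF matrices_rank assms(1-4), where e = "\<lambda>_. zr"] assms(5)
  by simp

lemma kind_Nil: "length xs = m \<Longrightarrow> I (kind C m []) (w # xs) = zr"
  by (simp add: kind_def descend_Nil del: descend.simps)

lemma rank_Nil: "length xs = m \<Longrightarrow> I (rank C m []) (w # xs) = zr"
  by (simp add: rank_def descend_Nil del: descend.simps)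

lemma kind_bit:
  "candidates m L \<Longrightarrow> 0 < m \<Longrightarrow> length xs = m \<Longrightarrow> \<exists>b. I (kind C m L) (w # xs) = bool_val b"
proof (induction m L arbitrary: xs rule: candidates.induct)
  case (1 m)
  then show ?case by (auto simp: kind_Nil intro!: exI[of _ False])
next
  case (2 m b g L)
  let ?d = "I (least m (refutes m (C b) g)) (w # xs)"
  show ?case
    using 2(1)[of "xs @ [?d]"] 2(2-) kind_Cons[of m g L xs ?d b w] by auto
qed

lemma rank_le:
  "candidates m L \<Longrightarrow> 0 < m \<Longrightarrow> length xs = m \<Longrightarrow> I (rank C m L) (w # xs) \<sqsubseteq> num (length L)"
proof (induction m L arbitrary: xs rule: candidates.induct)
  case (1 m)
  then show ?case by (simp add: kind_Nil rank_Nil)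
next
  case (2 m b g L)
  let ?d = "I (least m (refutes m (C b) g)) (w # xs)"
  have "I (rank C (Suc m) L) (w # xs @ [?d]) \<sqsubseteq> num (length L)"
    using 2(1)[of "xs @ [?d]"] 2(2-) by simp
  then show ?case
    using 2(2-) rank_Cons[of m g L xs ?d b w] by (auto simp: le_sc)
qed

text \<open>If the head is refuted at stage \<open>w\<close>, its counterexample is stable and both
  stages continue with the same tail and arguments. Otherwise the rank at \<open>w\<close> is
  maximal; at the next stage either the head is still current, and nothing changes, or the rank is
  at most the length of the tail.\<close>

lemma rank_descends:
  "candidates m L \<Longrightarrow> 0 < m \<Longrightarrow> length xs = m \<Longrightarrow>
    I (rank C m L) (sc w # xs) \<sqsubseteq> I (rank C m L) (w # xs) \<and>
    (I (kind C m L) (w # xs) \<noteq> I (kind C m L) (sc w # xs) \<longrightarrow>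
      I (rank C m L) (sc w # xs) \<sqsubset> I (rank C m L) (w # xs))"
proof (induction m L arbitrary: xs rule: candidates.induct)
  case (1 m)
  then show ?case by (simp add: kind_Nil rank_Nil)
next
  case (2 m b g L)
  then have g: "has_arity m g" "candidates (Suc m) L" by auto
  define d where "d w = I (least m (refutes m (C b) g)) (w # xs)" for w
  note rank = rank_Cons[OF g 2(3,4) d_def]
  note kind = kind_Cons[OF g 2(3,4) d_def]
  show ?case
  proof (cases "d w \<sqsubset> w")
    case True
    then have "d (sc w) = d w"
      unfolding d_def using 2(3,4) matrices.refutes[OF matrices_kind g(1)]
      by (intro least_stable) (auto simp: le_sc)
    moreover from True have "d w \<sqsubset> sc w" by (simp add: less_sc less_imp_le)
    ultimately show ?thesis
      using True 2(1)[of "xs @ [d w]"] 2(4) g by (simp add: rank kind)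
  next
    case False
    have "I (rank C m ((b, g) # L)) (sc w # xs) \<sqsubseteq> num (Suc (length L))"
      using rank_le[OF 2(2-4), of "sc w"] by (simp)
    moreover have "I (rank C (Suc m) L) (sc w # xs @ [d (sc w)]) \<sqsubset> num (Suc (length L))"
      using rank_le[of "Suc m" L "xs @ [d (sc w)]" "sc w"] 2(4) g by (simp add: less_sc)
    ultimately show ?thesis
      using False by (auto simp: rank kind)
  qed
qed

text \<open>Recursion on the remaining candidates. A head without counterexamples is never passed
  over, so it is a witness of the limiting kind. A head with a counterexample is passed over from
  some stage on, possibly a nonstandard one, and the Herbrand disjunction is inherited by the
  tail.\<close>

lemma limit_witness:
  assumes "candidates m L" "0 < m" "length xs = m"
    and "\<And>w. w0 \<sqsubseteq> w \<Longrightarrow> I (kind C m L) (w # xs) = bool_val t"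
    and "\<And>ds. \<exists>i<length L.
      sat I (env3 (ds i) (I (snd (L ! i)) (xs @ map ds [0..<i])) (xs ! 0)) (C (fst (L ! i)))"
  shows "\<exists>v. \<forall>y. sat I (env3 y v (xs ! 0)) (C t)"
  using assms
proof (induction m L arbitrary: xs w0 rule: candidates.induct)
  case (1 m)
  then show ?case by simp
next
  case (2 m b g L)
  then have g: "has_arity m g" "candidates (Suc m) L" by auto
  let ?q = "refutes m (C b) g"
  define d where "d w = I (least m ?q) (w # xs)" for w
  note kind = kind_Cons[OF g 2(3,4) d_def]
  note q = matrices.refutes[OF matrices_kind g(1) 2(3), of b]
  note spec = least_spec[OF q 2(4), folded d_def, unfolded sat_refutes[OF 2(4,3)]]
  show ?case
  proof (cases "\<exists>y. \<not> sat I (env3 y (I g xs) (xs ! 0)) (C b)")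
    case True
    then obtain y where y: "\<not> sat I (env3 y (I g xs) (xs ! 0)) (C b)" by blast
    \<comment> \<open>The least counterexample rather than \<open>y\<close> itself: it is what every
      search from stage \<open>sc y\<close> on returns.\<close>
    define y' where "y' = d (sc y)"
    have found: "y' \<sqsubset> sc y"
      using spec(1)[where w = "sc y"] spec(2)[where i = y and w = "sc y"] y by (auto simp: y'_def less_sc le_sc)
    then have y': "\<not> sat I (env3 y' (I g xs) (xs ! 0)) (C b)"
      using spec(3)[where w = "sc y"] by (auto simp: y'_def)
    have d: "d w = y'" if "sc y \<sqsubseteq> w" for w
    proof -
      have "I (least m ?q) (sc y # xs) \<sqsubset> sc y" using found by (simp only: y'_def d_def)
      then show ?thesis unfolding d_def y'_def using that by (rule least_stable[OF q 2(4)])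
    qed
    have "\<exists>v. \<forall>y. sat I (env3 y v ((xs @ [y']) ! 0)) (C t)"
    \<comment> \<open>The new threshold is the larger of the old one and the stage at which the
      counterexample is found.\<close>
    proof (rule 2(1)[of "xs @ [y']" "if w0 \<sqsubseteq> sc y then sc y else w0"])
      show "candidates (Suc m) L" "0 < Suc m" "length (xs @ [y']) = Suc m" using g 2(4) by auto
    next
      fix w assume "(if w0 \<sqsubseteq> sc y then sc y else w0) \<sqsubseteq> w"
      then have w: "sc y \<sqsubseteq> w" "w0 \<sqsubseteq> w"
        using le_trans[of w0 "sc y" w] le_trans[of "sc y" w0 w] linear[of w0 "sc y"]
        by (auto split: if_splits)
      have "y' \<sqsubset> w" using found w(1) by (rule less_le_trans)
      then show "I (kind C (Suc m) L) (w # xs @ [y']) = bool_val t"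
        using 2(5)[OF w(2)] d[OF w(1)] by (simp add: kind)
    next
      fix ds
      \<comment> \<open>With \<open>y'\<close> put in front of \<open>ds\<close>, the disjunct of
        the head fails, so one of the tail holds.\<close>
      obtain i where i: "i < Suc (length L)" "sat I (env3 (case_nat y' ds i) (I (snd (((b, g) # L) ! i))
          (xs @ map (case_nat y' ds) [0..<i])) (xs ! 0)) (C (fst (((b, g) # L) ! i)))"
        using 2(6)[of "case_nat y' ds"] by auto
      with y' obtain j where j: "i = Suc j" by (cases i) auto
      have "map (case_nat y' ds) [0..<Suc j] = y' # map ds [0..<j]"
        by (simp add: upt_conv_Cons map_Suc_upt[symmetric] comp_def del: upt_Suc)
      then show "\<exists>i<length L. sat I (env3 (ds i) (I (snd (L ! i)) ((xs @ [y']) @ map ds [0..<i]))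
          ((xs @ [y']) ! 0)) (C (fst (L ! i)))"
        using i 2(3,4) by (intro exI[of _ j]) (simp add: j nth_append del: upt_Suc)
    qed
    then show ?thesis using 2(3,4) by (simp add: nth_append)
  next
    case False
    \<comment> \<open>An unsuccessful search returns its bound, so the head is current at stage
      \<open>w0\<close> and its tag is the limit.\<close>
    then have "d w0 = w0" using spec(3)[where w = w0] by auto
    then have "bool_val b = bool_val t" using 2(5)[of w0] by (simp add: kind)
    then have "b = t" by (auto split: if_splits)
    with False show ?thesis by blast
  qed
qed

end

section \<open>Limits and stabilization\<close>

lemma sat_Lim:
  "sat I e (Lim f c l) \<longleftrightarrow> (\<exists>m. \<forall>w. m \<sqsubseteq> w \<longrightarrow> I f [tval I e c, w] = tval I e l)"
  by (simp add: Defs.Lim_def le_def)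

text \<open>Either \<open>h\<close> later drops below its value at \<open>w0\<close>, which allows a
  smaller \<open>k\<close>, or it is constant from \<open>w0\<close> on, and then
  \<open>lowering\<close> forbids any change of \<open>f\<close>. Existence of a limit is not
  quantifier-free, hence the external induction on \<open>k\<close>; \<open>mono\<close> and the
  constancy of \<open>f\<close> in \<open>const\<close> are within reach of the induction of
  EA.\<close>

lemma stabilizes:
  assumes "has_arity 2 f" "has_arity 2 h"
    and descending: "\<And>w. I h [c, sc w] \<sqsubseteq> I h [c, w]"
    and lowering: "\<And>w. I f [c, w] \<noteq> I f [c, sc w] \<Longrightarrow> I h [c, sc w] \<sqsubset> I h [c, w]"
  shows "I h [c, w0] \<sqsubseteq> num k \<Longrightarrow> \<exists>m. \<forall>w. m \<sqsubseteq> w \<longrightarrow> I f [c, w] = I f [c, m]"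
proof (induction k arbitrary: w0)
  have mono: "w0 \<sqsubseteq> w \<longrightarrow> I h [c, w] \<sqsubseteq> I h [c, w0]" for w w0
  proof (rule definable_induct[of "Imp (Le (Var 1) (Var 0)) (Le (App h [Var 2, Var 0]) (App h [Var 2, Var 1]))"
        "\<lambda>w. w0 \<sqsubseteq> w \<longrightarrow> I h [c, w] \<sqsubseteq> I h [c, w0]" "case_nat w0 (\<lambda>_. c)"])
    show "w0 \<sqsubseteq> sc w \<longrightarrow> I h [c, sc w] \<sqsubseteq> I h [c, w0]"
      if "w0 \<sqsubseteq> w \<longrightarrow> I h [c, w] \<sqsubseteq> I h [c, w0]" for w
      using that descending le_trans by (auto simp: le_sc)
  qed (use assms in \<open>auto simp: le_def numeral_2_eq_2\<close>)
  have const: "\<exists>m. \<forall>w. m \<sqsubseteq> w \<longrightarrow> I f [c, w] = I f [c, m]"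
    if h: "\<And>w. w0 \<sqsubseteq> w \<Longrightarrow> I h [c, w] = I h [c, w0]" for w0
  proof -
    have "w0 \<sqsubseteq> w \<longrightarrow> I f [c, w] = I f [c, w0]" for w
    proof (rule definable_induct[of "Imp (Le (Var 1) (Var 0)) (Eq (App f [Var 2, Var 0]) (App f [Var 2, Var 1]))"
          "\<lambda>w. w0 \<sqsubseteq> w \<longrightarrow> I f [c, w] = I f [c, w0]" "case_nat w0 (\<lambda>_. c)"])
      show "w0 \<sqsubseteq> sc w \<longrightarrow> I f [c, sc w] = I f [c, w0]"
        if IH: "w0 \<sqsubseteq> w \<longrightarrow> I f [c, w] = I f [c, w0]" for w
      proof
        assume "w0 \<sqsubseteq> sc w"
        then consider "w0 \<sqsubseteq> w" | "w0 = sc w" by (auto simp: le_sc)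
        then show "I f [c, sc w] = I f [c, w0]"
        proof cases
          case 1
          then have "I h [c, sc w] = I h [c, w]" using h[of w] h[of "sc w"] by (simp add: le_sc)
          then have "I f [c, w] = I f [c, sc w]" using lowering[of w] by auto
          with IH 1 show ?thesis by simp
        qed simp
      qed
    qed (use assms in \<open>auto simp: le_def numeral_2_eq_2\<close>)
    then show ?thesis by blast
  qed
  {
    case 0
    then show ?case using mono[of w0] by (intro const[of w0]) auto
  next
    case (Suc k)
    show ?case
    proof (cases "\<exists>w. w0 \<sqsubseteq> w \<and> I h [c, w] \<sqsubset> I h [c, w0]")
      case True
      then obtain w where "I h [c, w] \<sqsubset> I h [c, w0]" by blast
      then have "I h [c, w] \<sqsubset> sc (num k)" using Suc.prems less_le_trans by simp
      then show ?thesis using Suc.IH by (simp add: less_sc)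
    next
      case False
      then show ?thesis using mono[of w0] by (intro const[of w0]) (metis le_less)
    qed
  }
qed

end


section \<open>The two directions\<close>

lemma sat_Exists_Forall:
  "fv p \<subseteq> {0, 1, 2} \<Longrightarrow>
    sat I e (Exists (Forall p)) \<longleftrightarrow> (\<exists>v. \<forall>y. sat I (env3 y v (e 0)) p)"
  by (simp add: sat_env3[where e = e])

lemma descent_if_equivalent:
  assumes A: "qf_matrix A" and B: "qf_matrix B"
    and equiv: "EA \<turnstile> Iff (Forall (Exists A)) (Exists (Forall B))"
  obtains f h n where "has_arity 2 f" "has_arity 2 h"
    and "EA \<turnstile> Or (Eq (App f [Var 0, Var 1]) zero_tm) (Eq (App f [Var 0, Var 1]) one_tm)"
    and "EA \<turnstile> Le (App h [Var 0, Var 1]) (numeral_tm n)"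
    and "EA \<turnstile> Le (App h [Var 0, succ_tm (Var 1)]) (App h [Var 0, Var 1])"
    and "EA \<turnstile> Imp (Neg (Eq (App f [Var 0, Var 1]) (App f [Var 0, succ_tm (Var 1)])))
      (Lt (App h [Var 0, succ_tm (Var 1)]) (App h [Var 0, Var 1]))"
    and "EA \<turnstile> Imp (Lim f (Var 0) zero_tm) (Exists (Forall B))"
    and "EA \<turnstile> Imp (Lim f (Var 0) one_tm) (Exists (Forall (Neg A)))"
proof -
  define C where "C b = (if b then Neg A else B)" for b
    \<comment> \<open>\<open>True\<close> marks the candidates for \<open>x\<close> and \<open>False\<close> those for \<open>z\<close>.\<close>
  have C: "qf_matrix (C b)" for b
    using A B by (auto simp: C_def qf_matrix_def)
  then have fv_C: "fv (C b) \<subseteq> {0, 1, 2}" for b by (simp add: qf_matrix_def)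
  have "\<exists>b v. \<forall>y. sat I (env3 y v c) (C b)"
    if "model EA I" for I :: "code \<Rightarrow> nat list \<Rightarrow> nat" and c
  proof -
    have "sat I (\<lambda>_. c) (Exists (Forall (C True))) \<or> sat I (\<lambda>_. c) (Exists (Forall (C False)))"
      using proves_sound[OF equiv that, of "\<lambda>_. c"] by (auto simp: C_def)
    then show ?thesis unfolding sat_Exists_Forall[OF fv_C] by blast
  qed
  from herbrand_candidates[of C, OF C this] obtain L :: "(bool \<times> code) list"
    where arity: "\<And>i. i < length L \<Longrightarrow> has_arity (Suc i) (snd (L ! i))"
    and L: "\<And>(I :: code \<Rightarrow> nat list \<Rightarrow> nat) c d. model EA I \<Longrightarrow>
      \<exists>i<length L. sat I (env3 (d i) (I (snd (L ! i)) (c # map d [0..<i])) c) (C (fst (L ! i)))"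
    by metis
  have cand: "candidates 1 L" using arity by (intro candidatesI) simp
  \<comment> \<open>The descent takes the stage first, as the bound of its searches, whereas
    \<open>f\<close> and \<open>h\<close> take \<open>c\<close> first.\<close>
  define swap where "swap F = code_of 2 (App F [Var 1, Var 0])" for F
  define f where "f = swap (kind C 1 L)"
  define h where "h = swap (rank C 1 L)"
  have "matrices C (\<lambda>b k. bit_tm b)" "matrices C (\<lambda>b k. numeral_tm (Suc k))"
    by (unfold_locales; auto simp: C)+
  then have ar: "has_arity 2 (kind C 1 L)" "has_arity 2 (rank C 1 L)"
    using matrices.has_arity_descend[OF _ cand] by (auto simp: kind_def rank_def numeral_2_eq_2)
  then have binary: "has_arity 2 f" "has_arity 2 h"
    by (auto simp: f_def h_def swap_def numeral_2_eq_2 has_arity_code_of)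
  have swap: "I (swap F) [c, w] = I F [w, c]"
    if "model EA I" "has_arity 2 F" for I :: "code \<Rightarrow> nat list \<Rightarrow> nat" and F c w
  proof -
    interpret EA_model I using that by unfold_locales
    have "wf_tm (App F [Var 1, Var 0])" using that(2) by (simp add: numeral_2_eq_2)
    then show ?thesis unfolding swap_def by (subst I_code_of) auto
  qed
  have I_f: "I f [c, w] = I (kind C 1 L) [w, c]" and I_h: "I h [c, w] = I (rank C 1 L) [w, c]"
    if "model EA I" for I :: "code \<Rightarrow> nat list \<Rightarrow> nat" and c w
    using swap[OF that] ar by (auto simp: f_def h_def)
  have limit: "EA \<turnstile> Imp (Lim f (Var 0) (bit_tm b)) (Exists (Forall (C b)))" for b
  proof (rule EA_completeness)
    show "wf_fm (Imp (Lim f (Var 0) (bit_tm b)) (Exists (Forall (C b))))"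
      using C[of b] binary by (auto simp: Defs.Lim_def qf_matrix_def numeral_2_eq_2)
    fix I :: "code \<Rightarrow> nat list \<Rightarrow> nat" and e assume I: "model EA I"
    then interpret EA_model I by unfold_locales
    have "sat I e (Exists (Forall (C b)))"
      if w0: "\<And>w. le w0 w \<Longrightarrow> I f [e 0, w] = tval I e (bit_tm b)" for w0
    proof -
      have "\<exists>v. \<forall>y. sat I (env3 y v ([e 0] ! 0)) (C b)"
      proof (rule limit_witness[where C = C, OF C cand, of "[e 0]" w0])
        show "I (kind C 1 L) (w # [e 0]) = (if b then sc zr else zr)" if "le w0 w" for w
          using w0[OF that] I_f[OF I] by (simp add: bit_tm_def)
        show "\<exists>i<length L. sat I (env3 (ds i) (I (snd (L ! i)) ([e 0] @ map ds [0..<i])) ([e 0] ! 0))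
            (C (fst (L ! i)))" for ds
          using L[OF I, of ds "e 0"] by simp
      qed auto
      then show ?thesis unfolding sat_Exists_Forall[OF fv_C] by simp
    qed
    then show "sat I e (Imp (Lim f (Var 0) (bit_tm b)) (Exists (Forall (C b))))"
      unfolding sat.simps(3) sat_Lim by auto
  qed
  show ?thesis
  proof (rule that[OF binary])
    show "EA \<turnstile> Imp (Lim f (Var 0) zero_tm) (Exists (Forall B))"
      using limit[of False] by (simp add: bit_tm_def C_def)
    show "EA \<turnstile> Imp (Lim f (Var 0) one_tm) (Exists (Forall (Neg A)))"
      using limit[of True] by (simp add: bit_tm_def C_def)
    show "EA \<turnstile> Or (Eq (App f [Var 0, Var 1]) zero_tm) (Eq (App f [Var 0, Var 1]) one_tm)"
    proof (rule EA_completeness)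
      fix I :: "code \<Rightarrow> nat list \<Rightarrow> nat" and e assume I: "model EA I"
      then interpret EA_model I by unfold_locales
      show "sat I e (Or (Eq (App f [Var 0, Var 1]) zero_tm) (Eq (App f [Var 0, Var 1]) one_tm))"
        using kind_bit[where C = C, OF C cand, where xs = "[e 0]" and w = "e 1"] by (auto simp: I_f[OF I])
    qed (use binary in \<open>simp add: numeral_2_eq_2\<close>)
    show "EA \<turnstile> Le (App h [Var 0, Var 1]) (numeral_tm (length L))"
    proof (rule EA_completeness)
      fix I :: "code \<Rightarrow> nat list \<Rightarrow> nat" and e assume I: "model EA I"
      then interpret EA_model I by unfold_locales
      show "sat I e (Le (App h [Var 0, Var 1]) (numeral_tm (length L)))"
        using rank_le[where C = C, OF C cand, where xs = "[e 0]" and w = "e 1"] by (auto simp: I_h[OF I] le_def)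
    qed (use binary in \<open>simp add: numeral_2_eq_2\<close>)
    show "EA \<turnstile> Le (App h [Var 0, succ_tm (Var 1)]) (App h [Var 0, Var 1])"
    proof (rule EA_completeness)
      fix I :: "code \<Rightarrow> nat list \<Rightarrow> nat" and e assume I: "model EA I"
      then interpret EA_model I by unfold_locales
      show "sat I e (Le (App h [Var 0, succ_tm (Var 1)]) (App h [Var 0, Var 1]))"
        using rank_descends[where C = C, OF C cand, where xs = "[e 0]" and w = "e 1"] by (auto simp: I_h[OF I] le_def)
    qed (use binary in \<open>simp add: numeral_2_eq_2\<close>)
    show "EA \<turnstile> Imp (Neg (Eq (App f [Var 0, Var 1]) (App f [Var 0, succ_tm (Var 1)])))
      (Lt (App h [Var 0, succ_tm (Var 1)]) (App h [Var 0, Var 1]))"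
    proof (rule EA_completeness)
      fix I :: "code \<Rightarrow> nat list \<Rightarrow> nat" and e assume I: "model EA I"
      then interpret EA_model I by unfold_locales
      show "sat I e (Imp (Neg (Eq (App f [Var 0, Var 1]) (App f [Var 0, succ_tm (Var 1)])))
          (Lt (App h [Var 0, succ_tm (Var 1)]) (App h [Var 0, Var 1])))"
        using rank_descends[where C = C, OF C cand, where xs = "[e 0]" and w = "e 1"]
        by (auto simp: I_h[OF I] I_f[OF I] le_def lt_def)
    qed (use binary in \<open>simp add: numeral_2_eq_2\<close>)
  qed
qed

lemma equivalent_if_descent:
  assumes A: "qf_matrix A" and B: "qf_matrix B" and binary: "has_arity 2 f" "has_arity 2 h"
    and f: "EA \<turnstile> Or (Eq (App f [Var 0, Var 1]) zero_tm) (Eq (App f [Var 0, Var 1]) one_tm)"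
    and bound: "EA \<turnstile> And (Lt (App h [Var 0, Var 1]) (numeral_tm K))
      (Le (App h [Var 0, succ_tm (Var 1)]) (App h [Var 0, Var 1]))"
    and lowering: "EA \<turnstile> Imp (Neg (Eq (App f [Var 0, Var 1]) (App f [Var 0, succ_tm (Var 1)])))
      (Lt (App h [Var 0, succ_tm (Var 1)]) (App h [Var 0, Var 1]))"
    and lim_0: "EA \<turnstile> Imp (Lim f (Var 0) zero_tm) (Exists (Forall B))"
    and lim_1: "EA \<turnstile> Imp (Lim f (Var 0) one_tm) (Exists (Forall (Neg A)))"
    and BA: "EA \<turnstile> Imp (Exists (Forall B)) (Forall (Exists A))"
  shows "EA \<turnstile> Iff (Forall (Exists A)) (Exists (Forall B))"
proof (rule EA_completeness)
  show "wf_fm (Iff (Forall (Exists A)) (Exists (Forall B)))"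
    using A B by (simp add: qf_matrix_def)
  fix I :: "code \<Rightarrow> nat list \<Rightarrow> nat" and e :: "nat \<Rightarrow> nat" assume I: "model EA I"
  then interpret EA_model I by unfold_locales
  note sound = proves_sound[OF _ I]
  have lt_num: "le (sc (I h [c, w])) (num K)" and desc: "le (I h [c, sc w]) (I h [c, w])" for c w
    using sound[OF bound, of "case_nat c (\<lambda>_. w)"] by (auto simp: le_def)
  have "le (I h [c, w]) (num K)" for c w
    using lt_num[of c w] le_trans[of _ "sc (I h [c, w])"] le_sc[of "I h [c, w]" "I h [c, w]"]
    by auto
  moreover have "I f [c, w] \<noteq> I f [c, sc w] \<Longrightarrow> lt (I h [c, sc w]) (I h [c, w])" for c w
    using sound[OF lowering, of "case_nat c (\<lambda>_. w)"] by (auto simp: le_def lt_def)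
  ultimately obtain m where m: "\<And>w. le m w \<Longrightarrow> I f [e 0, w] = I f [e 0, m]"
    using stabilizes[OF binary desc] by metis
  have "I f [e 0, m] = zr \<or> I f [e 0, m] = sc zr"
    using sound[OF f, of "case_nat (e 0) (\<lambda>_. m)"] by auto
  then have "(\<forall>w. le m w \<longrightarrow> I f [e 0, w] = zr) \<or> (\<forall>w. le m w \<longrightarrow> I f [e 0, w] = sc zr)"
    using m by metis
  then have "sat I e (Lim f (Var 0) zero_tm) \<or> sat I e (Lim f (Var 0) one_tm)"
    unfolding sat_Lim by (simp only: tval.simps list.map) blast
  then have "sat I e (Exists (Forall B)) \<or> sat I e (Exists (Forall (Neg A)))"
    using sound[OF lim_0, of e] sound[OF lim_1, of e] unfolding sat.simps(3) by blast
  \<comment> \<open>By \<open>BA\<close> a witness for \<open>B\<close> makes both sides true; a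
    witness for \<open>Neg A\<close> makes the left side false and, by the contrapositive of
    \<open>BA\<close>, the right side too.\<close>
  then show "sat I e (Iff (Forall (Exists A)) (Exists (Forall B)))"
    using sound[OF BA, of e] by auto
qed

theorem theorem3p1:
  fixes A B :: fm
  assumes "qf_matrix A" and "qf_matrix B"
  shows "EA \<turnstile> Iff (Forall (Exists A)) (Exists (Forall B)) \<longleftrightarrow>
    (\<exists>(f :: code) (K :: nat) (h :: code).
       let c = Var 0; w = Var 1;
           fw = App f [c, w]; fw' = App f [c, succ_tm w];
           hw = App h [c, w]; hw' = App h [c, succ_tm w]
       in
       has_arity 2 f \<and> (\<forall>a b. denote f [a, b] \<in> {0, 1}) \<and>
       EA \<turnstile> Or (Eq fw (numeral_tm 0)) (Eq fw (numeral_tm 1)) \<and>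
       has_arity 2 h \<and> (\<forall>a b. denote h [a, b] \<in> {..<K}) \<and>
       EA \<turnstile> And (Lt hw (numeral_tm K)) (Le hw' hw) \<and>
       EA \<turnstile> Imp (Neg (Eq fw fw')) (Lt hw' hw) \<and>
       EA \<turnstile> Imp (Lim f c (numeral_tm 0)) (Exists (Forall B)) \<and>
       EA \<turnstile> Imp (Lim f c (numeral_tm 1)) (Exists (Forall (Neg A))) \<and>
       EA \<turnstile> Imp (Exists (Forall B)) (Forall (Exists A)))"
    (is "?lhs \<longleftrightarrow> ?rhs")
proof
  assume ?lhs
  have wf: "wf_fm A" "wf_fm B" using assms by (auto simp: qf_matrix_def)
  obtain f h n where fh: "has_arity 2 f" "has_arity 2 h"
    and f: "EA \<turnstile> Or (Eq (App f [Var 0, Var 1]) zero_tm) (Eq (App f [Var 0, Var 1]) one_tm)"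
    and bound: "EA \<turnstile> Le (App h [Var 0, Var 1]) (numeral_tm n)"
    and desc: "EA \<turnstile> Le (App h [Var 0, succ_tm (Var 1)]) (App h [Var 0, Var 1])"
    and lowering: "EA \<turnstile> Imp (Neg (Eq (App f [Var 0, Var 1]) (App f [Var 0, succ_tm (Var 1)])))
      (Lt (App h [Var 0, succ_tm (Var 1)]) (App h [Var 0, Var 1]))"
    and lims: "EA \<turnstile> Imp (Lim f (Var 0) zero_tm) (Exists (Forall B))"
      "EA \<turnstile> Imp (Lim f (Var 0) one_tm) (Exists (Forall (Neg A)))"
    using descent_if_equivalent[OF assms \<open>?lhs\<close>] .
  have num: "tval denote e (numeral_tm k) = k" for e k
    by (induction k) auto
  have denote_f: "denote f [a, b] \<in> {0, 1}" for a b
    using proves_sound[OF f model_denote, of "case_nat a (\<lambda>_. b)"] by auto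
  have denote_h: "denote h [a, b] < Suc n" for a b
    using proves_sound[OF bound model_denote, of "case_nat a (\<lambda>_. b)"] by (simp add: num)
  \<comment> \<open>The bound \<open>n\<close> is inclusive, hence \<open>K = Suc n\<close>.
    Cancelling successors under truncated subtraction reduces the strict bound to the weak
    one.\<close>
  have "EA \<turnstile> And (Lt (App h [Var 0, Var 1]) (numeral_tm (Suc n)))
      (Le (App h [Var 0, succ_tm (Var 1)]) (App h [Var 0, Var 1]))"
  proof (rule EA_completeness)
    fix I :: "code \<Rightarrow> nat list \<Rightarrow> nat" and e assume I: "model EA I"
    then interpret EA_model I by unfold_locales
    show "sat I e (And (Lt (App h [Var 0, Var 1]) (numeral_tm (Suc n)))
        (Le (App h [Var 0, succ_tm (Var 1)]) (App h [Var 0, Var 1])))"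
      using proves_sound[OF bound I, of e] proves_sound[OF desc I, of e]
      by (simp add: sc_sub_sc del: sub_simps)
  qed (use fh in \<open>simp add: numeral_2_eq_2\<close>)
  moreover have "EA \<turnstile> Imp (Exists (Forall B)) (Forall (Exists A))"
  proof (rule EA_completeness)
    show "sat I e (Imp (Exists (Forall B)) (Forall (Exists A)))"
      if "model EA I" for I :: "code \<Rightarrow> nat list \<Rightarrow> nat" and e
      using proves_sound[OF \<open>?lhs\<close> that, of e] by simp
  qed (use wf in simp)
  ultimately show ?rhs
    unfolding Let_def using fh f denote_f denote_h lowering lims
    by (intro exI[of _ f] exI[of _ "Suc n"] exI[of _ h]) simp
next
  assume ?rhs
  then show ?lhs
    unfolding Let_def using equivalent_if_descent[OF assms] by auto
qed

end
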